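(* A height function $\mu\colon V(3_{21})\to\mathbb{R}$ induces a strong matroidal subdivision of $3_{21}$ if and only if $\mu\in\bigcap_{(A,B)}V^{\mathrm{trop}}(f^{E_7}_{A,B})$, where $(A,B)$ ranges over all pairs of elements of $W(E_7)/P_7$ at edge-distance $2$ in $3_{21}$.
   Context: $W=W(E_7)$ with root system $E_7$, $P_7$ the minuscule maximal parabolic subgroup, $3_{21}=\Delta(E_7/P_7)$ the convex hull of the $W$-orbit of a point with stabilizer $P_7$ (56 vertices identified with $W/P_7$). Each pair $(A,B)$ of vertices at edge-distance $2$ spans a 6-dimensional cross-polytope face with antipodal vertex pairs $(A,B),(C_1,C_1'),\dots,(C_5,C_5')$, and $f^{E_7}_{A,B}=x_A\odot x_B\oplus\bigoplus_{i=1}^5x_{C_i}\odot x_{C_i'}$ ($\oplus=\min$, $\odot=+$); $\mu\in V^{\mathrm{trop}}(f)$ means the minimum of the monomials at $\mu$ is attained at least twice. For $\mathcal{M}\subseteq W/P_7$, $\Delta(\mathcal{M})$ is the convex hull of the corresponding vertices; $\mathcal{M}$ is a strong Coxeter matroid if for all $A,B\in\mathcal{M}$ there is a reflection $s$ in a root of $E_7$ whose mirror separates $A$ and $B$ with $sA,sB\in\mathcal{M}$. The subdivision induced by $\mu$ (projection of lower faces of $\mathrm{conv}\{(v,\mu(v))\}$) is strong matroidal if every cell is $\Delta(\mathcal{M})$ for a strong Coxeter matroid $\mathcal{M}$. *)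

theory Defs
  imports "HOL-Analysis.Analysis"
begin

text \<open>
  The root system \<open>E\<^sub>7\<close> in the coordinates adapted to the subsystem \<open>A\<^sub>7\<close>: it spans the hyperplane
  of coordinate sum zero in \<open>\<real>\<^sup>8\<close>, and all of its 126 roots have norm \<open>\<surd>2\<close>.
\<close>

definition half_sign_vec :: "8 set \<Rightarrow> real ^ 8" where
  "half_sign_vec S = (\<chi> i. if i \<in> S then 1 / 2 else - 1 / 2)"

definition E7_roots :: "(real ^ 8) set" where
  "E7_roots = {axis i 1 - axis j 1 | i j. i \<noteq> j} \<union> {half_sign_vec S | S. card S = 4}"

text \<open>
  The simple roots \<open>\<alpha>\<^sub>1, \<dots>, \<alpha>\<^sub>7\<close> in Bourbaki's numbering: \<open>\<alpha>\<^sub>1, \<alpha>\<^sub>3, \<alpha>\<^sub>4, \<alpha>\<^sub>5, \<alpha>\<^sub>6, \<alpha>\<^sub>7\<close> form a chain in the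
  Dynkin diagram, and \<open>\<alpha>\<^sub>2\<close> is joined to \<open>\<alpha>\<^sub>4\<close>.
\<close>

definition E7_simple_root :: "nat \<Rightarrow> real ^ 8" where
  "E7_simple_root k =
     (if k = 1 then axis 1 1 - axis 2 1
      else if k = 2 then half_sign_vec {4, 5, 6, 7}
      else if k = 3 then axis 2 1 - axis 3 1
      else if k = 4 then axis 3 1 - axis 4 1
      else if k = 5 then axis 4 1 - axis 5 1
      else if k = 6 then axis 5 1 - axis 6 1
      else if k = 7 then axis 6 1 - axis 7 1
      else 0)"

definition root_refl :: "'a::real_inner \<Rightarrow> 'a \<Rightarrow> 'a" where
  "root_refl \<alpha> x = x - (2 * (x \<bullet> \<alpha>) / (\<alpha> \<bullet> \<alpha>)) *\<^sub>R \<alpha>"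

text \<open>
  The group generated by the reflections in the vectors of \<open>R\<close>. Closure under inverses need not be
  imposed, since reflections are involutions.
\<close>

inductive_set refl_group :: "'a::real_inner set \<Rightarrow> ('a \<Rightarrow> 'a) set" for R where
  id: "id \<in> refl_group R"
| step: "\<alpha> \<in> R \<Longrightarrow> w \<in> refl_group R \<Longrightarrow> root_refl \<alpha> \<circ> w \<in> refl_group R"

definition W_E7 :: "(real ^ 8 \<Rightarrow> real ^ 8) set" where
  "W_E7 = refl_group E7_roots"

text \<open>
  The maximal parabolic subgroup belonging to the (only) minuscule node of the \<open>E\<^sub>7\<close> diagram; it is
  of type \<open>E\<^sub>6\<close> and generated by all simple reflections but the seventh.
\<close>

definition P7 :: "(real ^ 8 \<Rightarrow> real ^ 8) set" where
  "P7 = refl_group (E7_simple_root ` {1..6})"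

definition stabilizer_E7 :: "real ^ 8 \<Rightarrow> (real ^ 8 \<Rightarrow> real ^ 8) set" where
  "stabilizer_E7 p = {w \<in> W_E7. w p = p}"

text \<open>
  Throughout, \<open>p\<close> is a point with stabilizer \<open>P\<^sub>7\<close>. The coset \<open>w P\<^sub>7\<close> is identified with the point
  \<open>w p\<close>, so that \<open>W(E\<^sub>7)/P\<^sub>7\<close> becomes the orbit of \<open>p\<close>, with the action of the group by left
  multiplication becoming the linear action.
\<close>

definition verts_321 :: "real ^ 8 \<Rightarrow> (real ^ 8) set" where
  "verts_321 p = (\<lambda>w. w p) ` W_E7"

definition Delta :: "(real ^ 8) set \<Rightarrow> (real ^ 8) set" where
  "Delta M = convex hull M"

definition poly_321 :: "real ^ 8 \<Rightarrow> (real ^ 8) set" where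
  "poly_321 p = Delta (verts_321 p)"

definition edge_rel_321 :: "real ^ 8 \<Rightarrow> (real ^ 8) rel" where
  "edge_rel_321 p =
     {(A, B). A \<in> verts_321 p \<and> B \<in> verts_321 p \<and> closed_segment A B edge_of poly_321 p}"

definition at_edge_distance_321 :: "real ^ 8 \<Rightarrow> nat \<Rightarrow> real ^ 8 \<Rightarrow> real ^ 8 \<Rightarrow> bool" where
  "at_edge_distance_321 p n A B \<longleftrightarrow>
     A \<in> verts_321 p \<and> B \<in> verts_321 p \<and>
     (A, B) \<in> edge_rel_321 p ^^ n \<and> (\<forall>m < n. (A, B) \<notin> edge_rel_321 p ^^ m)"

definition spanned_face_321 :: "real ^ 8 \<Rightarrow> real ^ 8 \<Rightarrow> real ^ 8 \<Rightarrow> (real ^ 8) set" where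
  "spanned_face_321 p A B = \<Inter> {F. F face_of poly_321 p \<and> A \<in> F \<and> B \<in> F}"

text \<open>
  A tropical polynomial all of whose monomials are squarefree with coefficient \<open>0\<close> (the tropical
  one) is represented by the set of the supports of its monomials; the monomial with support \<open>m\<close>
  takes the value \<open>\<Sum>x\<in>m. \<mu> x\<close> at \<open>\<mu>\<close>. The set \<open>trop_V f\<close> consists of the \<open>\<mu>\<close> at which the minimum is
  attained by at least two monomials.
\<close>

definition trop_V :: "'v set set \<Rightarrow> ('v \<Rightarrow> real) set" where
  "trop_V f = {\<mu>. \<exists>m\<in>f. \<exists>m'\<in>f. m \<noteq> m' \<and> (\<Sum>x\<in>m. \<mu> x) = (\<Sum>x\<in>m'. \<mu> x) \<and>
                     (\<forall>k\<in>f. (\<Sum>x\<in>m. \<mu> x) \<le> (\<Sum>x\<in>k. \<mu> x))}"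

text \<open>
  The polynomial \<open>f\<^sub>A\<^sub>,\<^sub>B\<close> for \<open>A\<close>, \<open>B\<close> at edge-distance 2. The face spanned by \<open>A\<close> and \<open>B\<close> is a
  cross-polytope with centre \<open>midpoint A B\<close>, and two of its vertices are antipodal iff they are
  exchanged by the reflection in this centre. Its monomials are \<open>x\<^sub>A \<odot> x\<^sub>B\<close> and the five
  \<open>x\<^sub>C \<odot> x\<^sub>C'\<close> for the other antipodal pairs.
\<close>

definition f_E7 :: "real ^ 8 \<Rightarrow> real ^ 8 \<Rightarrow> real ^ 8 \<Rightarrow> (real ^ 8) set set" where
  "f_E7 p A B =
     {{C, C'} | C C'. C \<in> verts_321 p \<inter> spanned_face_321 p A B \<and>
                      C' \<in> verts_321 p \<inter> spanned_face_321 p A B \<and>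
                      midpoint C C' = midpoint A B}"

text \<open>
  The mirror of the root \<open>\<alpha>\<close> separates \<open>A\<close> and \<open>B\<close> if they lie strictly on opposite sides. In particular
  nothing separates a vertex from itself, so that the exchange condition concerns distinct \<open>A\<close>, \<open>B\<close>.
\<close>

definition mirror_separates :: "'a::real_inner \<Rightarrow> 'a \<Rightarrow> 'a \<Rightarrow> bool" where
  "mirror_separates \<alpha> A B \<longleftrightarrow>
     (A \<bullet> \<alpha> < 0 \<and> 0 < B \<bullet> \<alpha>) \<or> (B \<bullet> \<alpha> < 0 \<and> 0 < A \<bullet> \<alpha>)"

definition strong_coxeter_matroid :: "real ^ 8 \<Rightarrow> (real ^ 8) set \<Rightarrow> bool" where
  "strong_coxeter_matroid p M \<longleftrightarrow>
     M \<subseteq> verts_321 p \<and>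
     (\<forall>A\<in>M. \<forall>B\<in>M. A \<noteq> B \<longrightarrow>
        (\<exists>\<alpha>\<in>E7_roots. mirror_separates \<alpha> A B \<and> root_refl \<alpha> A \<in> M \<and> root_refl \<alpha> B \<in> M))"

definition lifted_polytope :: "'a::real_inner set \<Rightarrow> ('a \<Rightarrow> real) \<Rightarrow> ('a \<times> real) set" where
  "lifted_polytope V \<mu> = convex hull ((\<lambda>v. (v, \<mu> v)) ` V)"

text \<open>
  A lower face is the set of minimizers of a linear functional with positive last coordinate, which
  may be normalized to \<open>1\<close>.
\<close>

definition lower_faces :: "('a::real_inner \<times> real) set \<Rightarrow> ('a \<times> real) set set" where
  "lower_faces P = {F. \<exists>u. F = {z \<in> P. \<forall>y \<in> P. (u, 1) \<bullet> z \<le> (u, 1) \<bullet> y}}"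

definition induced_subdivision :: "'a::real_inner set \<Rightarrow> ('a \<Rightarrow> real) \<Rightarrow> 'a set set" where
  "induced_subdivision V \<mu> = (\<lambda>F. fst ` F) ` lower_faces (lifted_polytope V \<mu>)"

definition induces_strong_matroidal :: "real ^ 8 \<Rightarrow> (real ^ 8 \<Rightarrow> real) \<Rightarrow> bool" where
  "induces_strong_matroidal p \<mu> \<longleftrightarrow>
     (\<forall>Q \<in> induced_subdivision (verts_321 p) \<mu>. \<exists>M. strong_coxeter_matroid p M \<and> Q = Delta M)"

end

theory Submission
  imports Defs
begin

text \<open>
  The vertices are, up to a common factor, the 56 weights \<open>\<plusminus> wt i j\<close> of the minuscule representation,
  and \<open>wt i j \<bullet> wt k l\<close> and its negatives only take the values \<open>\<plusminus> 1/2\<close>, \<open>\<plusminus> 3/2\<close>. Pairs at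
  edge-distance 2 have inner product \<open>- 1/2\<close>, their sum is a root \<open>\<alpha>\<close>, and \<open>f\<close> is the sum over the
  six ways of writing \<open>\<alpha>\<close> as a sum of two weights. The cells of the subdivision are the hulls of the sets of
  minimizers of \<open>\<mu>\<close> plus a linear functional, and adding a linear functional does not change the
  tropical conditions.

  If one of the six pairs of \<open>\<alpha>\<close> is the unique minimum, a suitable linear functional makes this pair a cell,
  which is not a strong matroid. Conversely let \<open>\<mu> \<ge> 0\<close> satisfy the tropical conditions and let
  \<open>M\<close> be its zero set. For \<open>A\<close>, \<open>B\<close> in \<open>M\<close> at distance 2 the second minimal monomial gives the exchange. For
  antipodal \<open>A\<close>, \<open>B = - A\<close> one needs a neighbour \<open>C\<close> of \<open>A\<close> with \<open>C\<close> and \<open>- C\<close> in \<open>M\<close>: if there is none, the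
  zeros among the 27 neighbours and those among the 27 antipodes of neighbours are disjoint patterns on the
  27 lines of a cubic surface, constrained through the 45 tritangent planes, and these constraints leave
  only the empty patterns; but then the least positive height violates a tropical condition.
\<close>

section \<open>Zero patterns on the 27 lines\<close>

text \<open>The trace of a tropical condition on the zero set of a nonnegative height: if the
  minimum of the six monomials is attained at least twice, then either none of them vanishes or at
  least two do.\<close>

definition not_once :: "bool \<Rightarrow> bool \<Rightarrow> bool \<Rightarrow> bool \<Rightarrow> bool \<Rightarrow> bool \<Rightarrow> bool" where
  "not_once P Q R S T U \<longleftrightarrow>
     (P \<longrightarrow> Q \<or> R \<or> S \<or> T \<or> U) \<and> (Q \<longrightarrow> P \<or> R \<or> S \<or> T \<or> U) \<and>
     (R \<longrightarrow> P \<or> Q \<or> S \<or> T \<or> U) \<and> (S \<longrightarrow> P \<or> Q \<or> R \<or> T \<or> U) \<and>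
     (T \<longrightarrow> P \<or> Q \<or> R \<or> S \<or> U) \<and> (U \<longrightarrow> P \<or> Q \<or> R \<or> S \<or> T)"

text \<open>With \<open>card I = 6\<close> these are exactly the enumerations of \<open>I\<close>,
  so the rules of the locale below may be used for any relabelling.\<close>

definition six :: "'i set \<Rightarrow> 'i \<Rightarrow> 'i \<Rightarrow> 'i \<Rightarrow> 'i \<Rightarrow> 'i \<Rightarrow> 'i \<Rightarrow> bool" where
  "six I k l m n p q \<longleftrightarrow> distinct [k, l, m, n, p, q] \<and> {k, l, m, n, p, q} \<subseteq> I"

text \<open>
  For the vertex \<open>A = wt a b\<close> (below) and \<open>I\<close> the set of the six other indices, \<open>sa k\<close>, \<open>sb k\<close>, \<open>sc k l\<close>
  say that the height vanishes at the neighbour \<open>wt a k\<close>, \<open>wt b k\<close>, \<open>- wt k l\<close> of \<open>A\<close>, and \<open>ta\<close>,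
  \<open>tb\<close>, \<open>tc\<close> that it vanishes at the antipode of that neighbour. The indexing is that of the 27 lines
  on a cubic surface by a double-six; the six arguments of \<open>not_once\<close> are the monomials of
  \<open>f\<close> for the roots \<open>A - C\<close> and \<open>C - A\<close> with \<open>C\<close> a neighbour of \<open>A\<close>, that is, a line and the five
  tritangent planes through it.
\<close>

locale tropical_double_six =
  fixes I :: "'i set" and sa sb ta tb :: "'i \<Rightarrow> bool" and sc tc :: "'i \<Rightarrow> 'i \<Rightarrow> bool"
  assumes card_I: "card I = 6"
    and sc_sym: "sc k l = sc l k" and tc_sym: "tc k l = tc l k"
    and disj_a: "k \<in> I \<Longrightarrow> \<not> (sa k \<and> ta k)"
    and disj_b: "k \<in> I \<Longrightarrow> \<not> (sb k \<and> tb k)"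
    and disj_c: "k \<in> I \<Longrightarrow> l \<in> I \<Longrightarrow> k \<noteq> l \<Longrightarrow> \<not> (sc k l \<and> tc k l)"
    and sa_rule: "six I k l m n p q \<Longrightarrow> not_once (sa k) (tb l \<and> tc k l)
       (tb m \<and> tc k m) (tb n \<and> tc k n) (tb p \<and> tc k p) (tb q \<and> tc k q)"
    and sb_rule: "six I k l m n p q \<Longrightarrow> not_once (sb k) (ta l \<and> tc k l)
       (ta m \<and> tc k m) (ta n \<and> tc k n) (ta p \<and> tc k p) (ta q \<and> tc k q)"
    and sc_rule: "six I k l m n p q \<Longrightarrow> not_once (sc k l) (ta k \<and> tb l) (ta l \<and> tb k)
       (tc m n \<and> tc p q) (tc m p \<and> tc n q) (tc m q \<and> tc n p)"
    and ta_rule: "six I k l m n p q \<Longrightarrow> not_once (ta k) (sb l \<and> sc k l)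
       (sb m \<and> sc k m) (sb n \<and> sc k n) (sb p \<and> sc k p) (sb q \<and> sc k q)"
    and tb_rule: "six I k l m n p q \<Longrightarrow> not_once (tb k) (sa l \<and> sc k l)
       (sa m \<and> sc k m) (sa n \<and> sc k n) (sa p \<and> sc k p) (sa q \<and> sc k q)"
    and tc_rule: "six I k l m n p q \<Longrightarrow> not_once (tc k l) (sa k \<and> sb l) (sa l \<and> sb k)
       (sc m n \<and> sc p q) (sc m p \<and> sc n q) (sc m q \<and> sc n p)"
begin

text \<open>The reversed enumeration supplies every disequality of indices in the opposite
  orientation, which the simplifier needs.\<close>

lemma six_rev: "six I k l m n p q \<Longrightarrow> six I q p n m l k"
  by (auto simp: six_def)

text \<open>
  Two lines of a tritangent plane with zeros in \<open>s\<close>, together with the zeros in \<open>t\<close> that they force,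
  form one of two configurations up to relabelling. Each contradicts the finite set of conditions
  listed here, which was found as a minimal unsatisfiable core.
\<close>

lemma grid_with_pair:
  assumes six: "six I x0 x1 x2 x3 x4 x5"
    and hyp: "ta x0" "sb x1" "sc x0 x1" "ta x2" "tc x1 x2" "ta x1" "tb x0"
  shows False
proof -
  note ix = six[unfolded six_def, simplified] six_rev[OF six, unfolded six_def, simplified]
  note discharge = ix six_def distinct.simps list.set insert_iff empty_iff insert_subset empty_subsetI
    simp_thms True_implies_equals
  note inst =
    sa_rule[of x1 x0 x2 x3 x4 x5] sa_rule[of x3 x0 x1 x2 x4 x5] sa_rule[of x4 x0 x1 x2 x3 x5]
    sc_rule[of x1 x4 x0 x2 x3 x5] sc_rule[of x2 x3 x0 x1 x4 x5] sc_rule[of x2 x4 x0 x1 x3 x5]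
    sc_rule[of x2 x5 x0 x1 x3 x4] ta_rule[of x2 x0 x1 x3 x4 x5] ta_rule[of x3 x0 x1 x2 x4 x5]
    tb_rule[of x0 x1 x2 x3 x4 x5] tb_rule[of x2 x0 x1 x3 x4 x5] tb_rule[of x4 x0 x1 x2 x3 x5]
    tc_rule[of x0 x3 x1 x2 x4 x5] tc_rule[of x0 x4 x1 x2 x3 x5] tc_rule[of x0 x5 x1 x2 x3 x4]
    tc_rule[of x1 x2 x0 x3 x4 x5] tc_rule[of x1 x4 x0 x2 x3 x5] tc_rule[of x2 x5 x0 x1 x3 x4]
    tc_rule[of x3 x5 x0 x1 x2 x4] tc_rule[of x4 x5 x0 x1 x2 x3]
  note disj =
    disj_a[of x0] disj_a[of x1] disj_a[of x2] disj_a[of x3] disj_a[of x4] disj_a[of x5]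
    disj_b[of x0] disj_b[of x1] disj_b[of x2] disj_b[of x3] disj_b[of x4] disj_b[of x5]
    disj_c[of x0 x1] disj_c[of x0 x2] disj_c[of x0 x3] disj_c[of x0 x4] disj_c[of x0 x5]
    disj_c[of x1 x2] disj_c[of x1 x3] disj_c[of x1 x4] disj_c[of x1 x5] disj_c[of x2 x3]
    disj_c[of x2 x4] disj_c[of x2 x5] disj_c[of x3 x4] disj_c[of x3 x5] disj_c[of x4 x5]
  \<comment> \<open>Simplification by \<open>discharge\<close> removes the premises on the indices.
    The symmetry laws act as ordered rewriting, so that the same line always appears with its
    indices in the same order. What remains is propositional.\<close>
  from hyp inst[simplified discharge sc_sym tc_sym, unfolded not_once_def] disj[simplified discharge]
  show False
    by (smt (z3))
qed

lemma grid_with_syntheme: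
  assumes six: "six I x0 x1 x2 x3 x4 x5"
    and hyp: "ta x0" "sb x1" "sc x0 x1" "ta x2" "tc x1 x2" "tc x2 x3" "tc x4 x5"
  shows False
proof -
  note ix = six[unfolded six_def, simplified] six_rev[OF six, unfolded six_def, simplified]
  note discharge = ix six_def distinct.simps list.set insert_iff empty_iff insert_subset empty_subsetI
    simp_thms True_implies_equals
  note inst =
    sa_rule[of x3 x0 x1 x2 x4 x5] sb_rule[of x0 x1 x2 x3 x4 x5] sb_rule[of x4 x0 x1 x2 x3 x5]
    sb_rule[of x5 x0 x1 x2 x3 x4] sc_rule[of x0 x3 x1 x2 x4 x5] sc_rule[of x0 x5 x1 x2 x3 x4]
    sc_rule[of x1 x2 x0 x3 x4 x5] sc_rule[of x1 x4 x0 x2 x3 x5] sc_rule[of x1 x5 x0 x2 x3 x4]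
    sc_rule[of x2 x3 x0 x1 x4 x5] sc_rule[of x3 x4 x0 x1 x2 x5] ta_rule[of x2 x0 x1 x3 x4 x5]
    tb_rule[of x0 x1 x2 x3 x4 x5] tb_rule[of x1 x0 x2 x3 x4 x5] tb_rule[of x2 x0 x1 x3 x4 x5]
    tb_rule[of x3 x0 x1 x2 x4 x5] tc_rule[of x0 x2 x1 x3 x4 x5] tc_rule[of x0 x4 x1 x2 x3 x5]
    tc_rule[of x0 x5 x1 x2 x3 x4] tc_rule[of x2 x3 x0 x1 x4 x5] tc_rule[of x2 x4 x0 x1 x3 x5]
    tc_rule[of x4 x5 x0 x1 x2 x3]
  note disj =
    disj_a[of x0] disj_a[of x1] disj_a[of x2] disj_a[of x3] disj_a[of x4] disj_a[of x5]
    disj_b[of x0] disj_b[of x1] disj_b[of x2] disj_b[of x3] disj_b[of x4] disj_b[of x5]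
    disj_c[of x0 x1] disj_c[of x0 x2] disj_c[of x0 x3] disj_c[of x0 x4] disj_c[of x0 x5]
    disj_c[of x1 x2] disj_c[of x1 x3] disj_c[of x1 x4] disj_c[of x1 x5] disj_c[of x2 x3]
    disj_c[of x2 x4] disj_c[of x2 x5] disj_c[of x3 x4] disj_c[of x3 x5] disj_c[of x4 x5]
  from hyp inst[simplified discharge sc_sym tc_sym, unfolded not_once_def] disj[simplified discharge]
  show False
    by (smt (z3))
qed

lemma not_once_D1: "not_once P Q R S T U \<Longrightarrow> P \<Longrightarrow> Q \<or> R \<or> S \<or> T \<or> U"
  by (simp add: not_once_def)

lemma not_once_swap: "not_once P Q R S T U \<Longrightarrow> not_once P R Q S T U"
  by (auto simp: not_once_def)

lemma six_perms:
  assumes "six I k l m n p q"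
  shows "six I l k m n p q" "six I k m l n p q" "six I k n l m p q" "six I k p l m n q" "six I k q l m n p"
    "six I m n k l p q"
  using assms by (auto simp: six_def)

lemma ex_six:
  assumes "k \<in> I"
  obtains l m n p q where "six I k l m n p q"
proof -
  have "finite I" using card_I by (auto intro: card_ge_0_finite)
  with assms card_I have "card (I - {k}) = 5" "finite (I - {k})" by auto
  then obtain xs where "set xs = I - {k}" "distinct xs" "length xs = 5"
    by (metis finite_distinct_list distinct_card)
  moreover from this obtain l m n p q where "xs = [l, m, n, p, q]"
    by (auto simp: numeral_eq_Suc length_Suc_conv)
  ultimately have "six I k l m n p q" using assms by (auto simp: six_def)
  with that show thesis .
qed

text \<open>One zero propagates: \<open>ta_rule\<close> yields a tritangent plane whose other two
  lines are zeros in \<open>s\<close>; \<open>sb_rule\<close> applied to one of them and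
  \<open>sc_rule\<close> to the other force further zeros in \<open>t\<close>, and disjointness
  leaves only the two grid configurations excluded above.\<close>

lemma not_ta:
  assumes "k \<in> I"
  shows "\<not> ta k"
proof
  assume ta: "ta k"
  obtain l m n p q where six: "six I k l m n p q" using ex_six[OF assms] .
  \<comment> \<open>The five alternatives differ only by which index is called \<open>l\<close>, so
    they merge after permuting the enumeration.\<close>
  from not_once_D1[OF ta_rule[OF six] ta] six six_perms[OF six]
  obtain l m n p q where six: "six I k l m n p q" and l: "sb l" "sc k l"
    by (elim disjE conjE) blast+
  have kl: "k \<in> I" "l \<in> I" "k \<noteq> l" using six by (auto simp: six_def)
  have nc: "\<not> tc k l" "\<not> tc l k" "\<not> tb l" using kl l disj_b disj_c[OF kl] tc_sym[of k l] by auto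
  have perms: "six I k l n m p q" "six I k l p m n q" "six I k l q m n p"
    using six by (auto simp: six_def)
  from not_once_D1[OF sb_rule[OF six_perms(1)[OF six]] l(1)] nc
  have "ta m \<and> tc l m \<or> ta n \<and> tc l n \<or> ta p \<and> tc l p \<or> ta q \<and> tc l q"
    by simp
  with six perms obtain m n p q where six: "six I k l m n p q" and m: "ta m" "tc l m"
    by (elim disjE conjE) blast+
  have perms: "six I k l m p n q" "six I k l m q n p"
    using six by (auto simp: six_def)
  from not_once_D1[OF sc_rule[OF six] l(2)] nc
  consider "ta l" "tb k" | "tc m n" "tc p q" | "tc m p" "tc n q" | "tc m q" "tc n p"
    by (elim disjE conjE) simp_all
  then show False
  proof cases
    case 1 then show False using grid_with_pair[OF six] ta l m by blast
  next
    case 2 then show False using grid_with_syntheme[OF six] ta l m by blast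
  next
    case 3 then show False using grid_with_syntheme[OF perms(1)] ta l m by blast
  next
    case 4 then show False using grid_with_syntheme[OF perms(2)] ta l m by blast
  qed
qed

text \<open>The conditions are invariant under exchanging the two rows of the double-six and under
  exchanging \<open>s\<close> with \<open>t\<close>. The four resulting instances of
  \<open>not_ta\<close> cover all four predicates; the row exchange only swaps two monomials in the
  rules for \<open>sc\<close> and \<open>tc\<close>.\<close>

lemma not_any:
  assumes "k \<in> I"
  shows "\<not> sa k" "\<not> sb k" "\<not> ta k" "\<not> tb k"
proof -
  have sc: "not_once (sc k l) (tb k \<and> ta l) (tb l \<and> ta k)
      (tc m n \<and> tc p q) (tc m p \<and> tc n q) (tc m q \<and> tc n p)"
    and tc: "not_once (tc k l) (sb k \<and> sa l) (sb l \<and> sa k)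
      (sc m n \<and> sc p q) (sc m p \<and> sc n q) (sc m q \<and> sc n p)"
    if "six I k l m n p q" for k l m n p q
    using not_once_swap[OF sc_rule[OF that]] not_once_swap[OF tc_rule[OF that]]
    by (simp_all only: conj_commute)
  interpret ab: tropical_double_six I sb sa tb ta sc tc
    by unfold_locales
      (fact card_I sc_sym tc_sym disj_a disj_b disj_c sa_rule sb_rule sc ta_rule tb_rule tc)+
  have disj: "k \<in> I \<Longrightarrow> \<not> (ta k \<and> sa k)" "k \<in> I \<Longrightarrow> \<not> (tb k \<and> sb k)"
    "k \<in> I \<Longrightarrow> l \<in> I \<Longrightarrow> k \<noteq> l \<Longrightarrow> \<not> (tc k l \<and> sc k l)" for k l
    using disj_a disj_b disj_c by auto
  interpret st: tropical_double_six I ta tb sa sb tc sc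
    by unfold_locales
      (fact card_I sc_sym tc_sym disj sa_rule sb_rule sc_rule ta_rule tb_rule tc_rule)+
  interpret abst: tropical_double_six I tb ta sb sa tc sc
    by unfold_locales
      (fact card_I sc_sym tc_sym disj sa_rule sb_rule sc ta_rule tb_rule tc)+
  show "\<not> sa k" "\<not> sb k" "\<not> ta k" "\<not> tb k"
    using not_ta ab.not_ta st.not_ta abst.not_ta assms by auto
qed

text \<open>Once the double-six is free of zeros, the fifteen remaining lines are the pairs of
  indices, and the tritangent planes they form are the partitions of the six indices into three
  pairs. The instances listed are again contradictory.\<close>

lemma two_synthemes:
  assumes six: "six I x0 x1 x2 x3 x4 x5"
    and hyp: "tc x0 x1" "sc x2 x3" "sc x4 x5"
  shows False
proof -
  note ix = six[unfolded six_def, simplified] six_rev[OF six, unfolded six_def, simplified]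
  note discharge = ix six_def distinct.simps list.set insert_iff empty_iff insert_subset empty_subsetI
    simp_thms True_implies_equals
  note inst =
    sc_rule[of x0 x3 x1 x2 x4 x5] sc_rule[of x0 x4 x1 x2 x3 x5] sc_rule[of x1 x3 x0 x2 x4 x5]
    sc_rule[of x1 x4 x0 x2 x3 x5] sc_rule[of x2 x3 x0 x1 x4 x5] sc_rule[of x3 x4 x0 x1 x2 x5]
    tc_rule[of x0 x5 x1 x2 x3 x4] tc_rule[of x1 x5 x0 x2 x3 x4] tc_rule[of x2 x5 x0 x1 x3 x4]
  note no_ab = not_any[of x0] not_any[of x1] not_any[of x2] not_any[of x3] not_any[of x4] not_any[of x5]
  note disj =
    disj_c[of x0 x1] disj_c[of x0 x2] disj_c[of x0 x3] disj_c[of x0 x4] disj_c[of x0 x5]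
    disj_c[of x1 x2] disj_c[of x1 x3] disj_c[of x1 x4] disj_c[of x1 x5] disj_c[of x2 x3]
    disj_c[of x2 x4] disj_c[of x2 x5] disj_c[of x3 x4] disj_c[of x3 x5] disj_c[of x4 x5]
  from hyp no_ab[simplified discharge] inst[simplified discharge sc_sym tc_sym, unfolded not_once_def] disj[simplified discharge]
  show False
    by (smt (z3))
qed

text \<open>With the double-six empty, only the three monomials of \<open>tc_rule\<close> that are
  built from pairs can accompany a zero, and they agree up to relabelling.\<close>

lemma not_tc:
  assumes "k \<in> I" "l \<in> I" "k \<noteq> l"
  shows "\<not> tc k l"
proof
  assume tc: "tc k l"
  obtain xs where xs: "set xs = I - {k, l}" "distinct xs" "length xs = 4"
  proof -
    have "finite (I - {k, l})" "card (I - {k, l}) = 4"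
      using card_I assms by (auto intro: card_ge_0_finite simp: card_Diff_subset)
    with that show thesis by (metis finite_distinct_list distinct_card)
  qed
  then obtain m n p q where "xs = [m, n, p, q]"
    by (auto simp: numeral_eq_Suc length_Suc_conv)
  with xs assms have six: "six I k l m n p q" by (auto simp: six_def)
  then have perms: "six I k l m p n q" "six I k l m q n p"
    by (auto simp: six_def)
  have I: "k \<in> I" "l \<in> I" using assms by auto
  from not_once_D1[OF tc_rule[OF six] tc] not_any[OF I(1)] not_any[OF I(2)]
  consider "sc m n" "sc p q" | "sc m p" "sc n q" | "sc m q" "sc n p"
    by (elim disjE conjE) simp_all
  then show False
    using two_synthemes[OF six tc] two_synthemes[OF perms(1) tc] two_synthemes[OF perms(2) tc]
    by cases blast+
qed

lemma no_zero:
  assumes "k \<in> I" "l \<in> I" "k \<noteq> l"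
  shows "\<not> sa k" "\<not> sb k" "\<not> ta k" "\<not> tb k" "\<not> sc k l" "\<not> tc k l"
proof -
  have disj: "k \<in> I \<Longrightarrow> \<not> (ta k \<and> sa k)" "k \<in> I \<Longrightarrow> \<not> (tb k \<and> sb k)"
    "k \<in> I \<Longrightarrow> l \<in> I \<Longrightarrow> k \<noteq> l \<Longrightarrow> \<not> (tc k l \<and> sc k l)" for k l
    using disj_a disj_b disj_c by auto
  interpret st: tropical_double_six I ta tb sa sb tc sc
    by unfold_locales
      (fact card_I sc_sym tc_sym disj sa_rule sb_rule sc_rule ta_rule tb_rule tc_rule)+
  show "\<not> sa k" "\<not> sb k" "\<not> ta k" "\<not> tb k" "\<not> sc k l" "\<not> tc k l"
    using not_any not_tc st.not_tc assms by auto
qed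

end

section \<open>The weights and the roots\<close>

text \<open>The projection of \<open>axis i 1 + axis j 1\<close> to the hyperplane of coordinate sum
  zero: a weight of the exterior square of the standard representation for the subsystem of type
  A7.\<close>

definition wt :: "8 \<Rightarrow> 8 \<Rightarrow> real ^ 8" where
  "wt i j = axis i 1 + axis j 1 - (\<chi> k. 1 / 4)"

definition weights :: "(real ^ 8) set" where
  "weights = {wt i j | i j. i \<noteq> j} \<union> {- wt i j | i j. i \<noteq> j}"

lemma wt_nth: "wt i j $ k = of_bool (k = i) + of_bool (k = j) - 1 / 4"
  by (auto simp: wt_def axis_def)

lemma wt_commute: "wt i j = wt j i"
  by (simp add: wt_def add.commute)

lemma inner_wt: "x \<bullet> wt i j = x $ i + x $ j - (\<Sum>k\<in>UNIV. x $ k) / 4"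
proof -
  have "x \<bullet> (\<chi> k. 1 / 4) = (\<Sum>k\<in>UNIV. x $ k) / 4"
    by (simp add: inner_vec_def sum_divide_distrib)
  then show ?thesis
    by (simp add: wt_def inner_diff_right inner_add_right inner_axis)
qed

lemma sum_wt: "(\<Sum>k\<in>UNIV. wt i j $ k) = 0"
proof -
  have "(\<Sum>k\<in>UNIV. of_bool (k = i) :: real) = 1" for i :: 8
    using sum.delta[of UNIV i "\<lambda>_. 1 :: real"] by (simp add: of_bool_def)
  then show ?thesis by (simp add: wt_nth sum_subtractf sum.distrib)
qed

text \<open>For two-element index sets this is the number of common indices minus 1/2.\<close>

lemma wt_inner_wt:
  "wt i j \<bullet> wt k l = of_bool (i = k) + of_bool (i = l) + of_bool (j = k) + of_bool (j = l) - 1 / 2"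
  unfolding inner_wt sum_wt by (auto simp: wt_nth)

lemma half_sign_vec_nth: "half_sign_vec S $ i = (if i \<in> S then 1 / 2 else - 1 / 2)"
  by (simp add: half_sign_vec_def)

lemma half_sign_vec_uminus: "half_sign_vec (- S) = - half_sign_vec S"
  by (simp add: vec_eq_iff half_sign_vec_nth)

lemma card_Compl_4:
  fixes S :: "8 set"
  shows "card (- S) = 4 \<longleftrightarrow> card S = 4"
proof -
  have "card (- S) = 8 - card S" "card S \<le> 8"
    using card_mono[of UNIV S] by (simp_all add: Compl_eq_Diff_UNIV card_Diff_subset)
  then show ?thesis by auto
qed

lemma sum_half_sign_vec:
  assumes "card S = 4"
  shows "(\<Sum>i\<in>UNIV. half_sign_vec S $ i) = 0"
proof -
  have half: "half_sign_vec S $ i = of_bool (i \<in> S) - 1 / 2" for i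
    by (simp add: half_sign_vec_nth)
  show ?thesis
    unfolding half sum_subtractf using assms by simp
qed

lemma half_inner_wt:
  assumes "card S = 4"
  shows "half_sign_vec S \<bullet> wt i j = of_bool (i \<in> S) + of_bool (j \<in> S) - 1"
  unfolding inner_wt sum_half_sign_vec[OF assms] by (simp add: half_sign_vec_nth)

lemma axis_diff_inner_wt:
  "(axis a 1 - axis b 1) \<bullet> wt i j =
    of_bool (a = i) + of_bool (a = j) - of_bool (b = i) - of_bool (b = j)"
  by (simp add: inner_commute[of _ "wt i j"] inner_diff_right inner_axis wt_nth)

lemma root_cases:
  assumes "\<alpha> \<in> E7_roots"
  obtains (diff) a b where "a \<noteq> b" "\<alpha> = axis a 1 - axis b 1"
  | (half) S where "card S = 4" "\<alpha> = half_sign_vec S"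
  using assms unfolding E7_roots_def by blast

lemma weight_cases:
  assumes "v \<in> weights"
  obtains (pos) i j where "i \<noteq> j" "v = wt i j" | (neg) i j where "i \<noteq> j" "v = - wt i j"
  using assms unfolding weights_def by blast

lemma wt_in_weights [simp]: "i \<noteq> j \<Longrightarrow> wt i j \<in> weights"
  by (auto simp: weights_def)

lemma uminus_in_weights [simp]: "- v \<in> weights \<longleftrightarrow> v \<in> weights"
proof -
  have "- x \<in> weights" if "x \<in> weights" for x
    using that by (auto simp: weights_def)
  from this[of v] this[of "- v"] show ?thesis by auto
qed

lemma axis_diff_root: "a \<noteq> b \<Longrightarrow> axis a 1 - axis b 1 \<in> E7_roots"
  unfolding E7_roots_def by auto

lemma uminus_root:
  assumes "\<alpha> \<in> E7_roots"
  shows "- \<alpha> \<in> E7_roots"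
  using assms
proof (cases rule: root_cases)
  case (diff a b)
  then show ?thesis using axis_diff_root[of b a] by simp
next
  case (half S)
  then have "- \<alpha> = half_sign_vec (- S)" "card (- S) = 4"
    by (simp_all add: half_sign_vec_uminus card_Compl_4)
  then show ?thesis unfolding E7_roots_def by blast
qed

lemma root_inner_self: "\<alpha> \<in> E7_roots \<Longrightarrow> \<alpha> \<bullet> \<alpha> = 2"
proof (erule root_cases)
  fix S assume "\<alpha> = half_sign_vec S"
  moreover have "half_sign_vec S \<bullet> half_sign_vec S = (\<Sum>i\<in>(UNIV :: 8 set). 1 / 4)"
    unfolding inner_vec_def by (rule sum.cong) (simp_all add: half_sign_vec_nth)
  ultimately show ?thesis by simp
qed (simp add: inner_diff_left inner_diff_right inner_axis_axis)

lemma weight_inner_self: "v \<in> weights \<Longrightarrow> v \<bullet> v = 3 / 2"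
  by (erule weight_cases) (auto simp: wt_inner_wt)

text \<open>This is minusculeness: a reflection shifts a weight by at most one root, and the value 1
  is the maximum of a root on the weights.\<close>

lemma weight_inner_root: "v \<in> weights \<Longrightarrow> \<alpha> \<in> E7_roots \<Longrightarrow> v \<bullet> \<alpha> \<in> {- 1, 0, 1}"
  by (elim weight_cases root_cases)
    (auto simp: inner_commute[of "wt _ _"] half_inner_wt axis_diff_inner_wt)

lemma weight_inner_weight:
  assumes "v \<in> weights" "w \<in> weights"
  shows "v \<bullet> w \<in> {- 3 / 2, - 1 / 2, 1 / 2, 3 / 2}"
proof -
  have "wt i j \<bullet> wt k l \<in> {- 1 / 2, 1 / 2, 3 / 2}" if "i \<noteq> j" "k \<noteq> l" for i j k l
    using that unfolding wt_inner_wt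
    by (cases "i = k"; cases "i = l"; cases "j = k"; cases "j = l") simp_all
  with assms show ?thesis
    by (elim weight_cases) fastforce+
qed

text \<open>All weights have squared norm 3/2, so this is the equality case of Cauchy-Schwarz.
  Applied with a negated weight it recognizes antipodes.\<close>

lemma weight_eqI:
  assumes "v \<in> weights" "w \<in> weights" "v \<bullet> w = 3 / 2"
  shows "v = w"
proof -
  have "(v - w) \<bullet> (v - w) = 0"
    using assms by (simp add: inner_diff_left inner_diff_right inner_commute[of w v] weight_inner_self)
  then show ?thesis by simp
qed

lemma wt_diff: "wt i j - wt i k = axis j 1 - axis k 1"
  by (simp add: wt_def)

lemma wt_add:
  assumes "distinct [i, j, k, l]"
  shows "wt i j + wt k l = half_sign_vec {i, j, k, l}"
  using assms by (auto simp: vec_eq_iff wt_nth half_sign_vec_nth)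

lemma half_sign_vec_root: "distinct [i, j, k, l] \<Longrightarrow> half_sign_vec {i, j, k, l} \<in> E7_roots"
  unfolding E7_roots_def by auto

text \<open>Weights of equal sign must share exactly one index, which leaves a difference of two
  unit vectors; weights of opposite sign have disjoint index pairs, whose union gives a half-sign
  vector.\<close>

lemma weight_diff_root:
  assumes "v \<in> weights" "w \<in> weights" "v \<bullet> w = 1 / 2"
  shows "v - w \<in> E7_roots"
proof -
  have pp: "wt i j - wt k l \<in> E7_roots" if "i \<noteq> j" "k \<noteq> l" "wt i j \<bullet> wt k l = 1 / 2" for i j k l
  proof -
    have "(i = k \<and> j \<noteq> l) \<or> (i = l \<and> j \<noteq> k) \<or> (j = k \<and> i \<noteq> l) \<or> (j = l \<and> i \<noteq> k)"
      using that by (auto simp: wt_inner_wt of_bool_def split: if_splits)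
    then show ?thesis
      using wt_diff wt_commute axis_diff_root by metis
  qed
  have pn: "wt i j + wt k l \<in> E7_roots" if "i \<noteq> j" "k \<noteq> l" "wt i j \<bullet> wt k l = - 1 / 2" for i j k l
  proof -
    have "distinct [i, j, k, l]"
      using that by (auto simp: wt_inner_wt of_bool_def split: if_splits)
    then show ?thesis using wt_add half_sign_vec_root by metis
  qed
  from assms show ?thesis
  proof (elim weight_cases)
    fix i j k l assume *: "i \<noteq> j" "v = wt i j" "k \<noteq> l" "w = wt k l"
    with assms pp show ?thesis by auto
  next
    fix i j k l assume *: "i \<noteq> j" "v = wt i j" "k \<noteq> l" "w = - wt k l"
    with assms pn[of i j k l] show ?thesis by auto
  next
    fix i j k l assume *: "i \<noteq> j" "v = - wt i j" "k \<noteq> l" "w = wt k l"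
    with assms uminus_root[OF pn[of i j k l]] show ?thesis by auto
  next
    fix i j k l assume *: "i \<noteq> j" "v = - wt i j" "k \<noteq> l" "w = - wt k l"
    with assms pp[of k l i j] show ?thesis by (auto simp: inner_commute)
  qed
qed

lemma card_4_obtain:
  fixes i j :: 'a
  assumes "card S = 4" "i \<in> S" "j \<in> S" "i \<noteq> j"
  obtains k l where "distinct [i, j, k, l]" "S = {i, j, k, l}"
proof -
  have "card (S - {i, j}) = 2"
    using assms by (simp add: card_Diff_subset)
  then obtain k l where "S - {i, j} = {k, l}" "k \<noteq> l" by (auto simp: card_2_iff)
  with assms have "distinct [i, j, k, l]" "S = {i, j, k, l}" by auto
  with that show thesis .
qed

text \<open>The difference is the image of \<open>v\<close> under the reflection in \<alpha>, so
  this contains the invariance of the weights under the group. The cases with a negative weight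
  follow by negating both vectors.\<close>

lemma weight_diff_weight:
  assumes "v \<in> weights" "\<alpha> \<in> E7_roots" "v \<bullet> \<alpha> = 1"
  shows "v - \<alpha> \<in> weights"
proof -
  have pp: "wt i j - (axis a 1 - axis b 1) \<in> weights"
    if "i \<noteq> j" "a \<noteq> b" "wt i j \<bullet> (axis a 1 - axis b 1) = 1" for i j a b
  proof -
    have "(a = i \<or> a = j) \<and> b \<noteq> i \<and> b \<noteq> j"
      using that by (auto simp: inner_commute[of "wt _ _"] axis_diff_inner_wt of_bool_def split: if_splits)
    then have "wt i j - (axis a 1 - axis b 1) \<in> {wt b j, wt i b}"
      by (auto simp: wt_def)
    with \<open>_ \<and> _\<close> show ?thesis by (auto simp: weights_def)
  qed
  have ph: "wt i j - half_sign_vec S \<in> weights"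
    if "i \<noteq> j" "card S = 4" "wt i j \<bullet> half_sign_vec S = 1" for i j S
  proof -
    have "i \<in> S" "j \<in> S"
      using that by (auto simp: inner_commute[of "wt _ _"] half_inner_wt of_bool_def split: if_splits)
    with that obtain k l where kl: "distinct [i, j, k, l]" "S = {i, j, k, l}"
      by (metis card_4_obtain)
    then have "wt i j - half_sign_vec S = - wt k l" using wt_add[of i j k l] by (simp add: algebra_simps)
    with kl show ?thesis by simp
  qed
  from assms(1,2) show ?thesis
  proof (elim weight_cases root_cases)
    fix i j a b assume *: "i \<noteq> j" "v = wt i j" "a \<noteq> b" "\<alpha> = axis a 1 - axis b 1"
    with pp[of i j a b] assms show ?thesis by simp
  next
    fix i j S assume *: "i \<noteq> j" "v = wt i j" "card S = 4" "\<alpha> = half_sign_vec S"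
    with ph[of i j S] assms show ?thesis by simp
  next
    fix i j a b assume *: "i \<noteq> j" "v = - wt i j" "a \<noteq> b" "\<alpha> = axis a 1 - axis b 1"
    then have "v - \<alpha> = - (wt i j - (axis b 1 - axis a 1))" by simp
    with * pp[of i j b a] assms(3) show ?thesis
      by (simp only: uminus_in_weights) (simp add: inner_diff_right)
  next
    fix i j S assume *: "i \<noteq> j" "v = - wt i j" "card S = 4" "\<alpha> = half_sign_vec S"
    with ph[of i j "- S"] assms card_Compl_4[of S] have "- (v - \<alpha>) \<in> weights"
      by (simp add: half_sign_vec_uminus algebra_simps)
    then show ?thesis by (simp only: uminus_in_weights)
  qed
qed

lemma root_refl_root: "\<alpha> \<in> E7_roots \<Longrightarrow> root_refl \<alpha> x = x - (x \<bullet> \<alpha>) *\<^sub>R \<alpha>"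
  by (simp add: root_refl_def root_inner_self)

lemma root_refl_weight:
  assumes "\<alpha> \<in> E7_roots" "v \<in> weights"
  shows "root_refl \<alpha> v \<in> weights"
proof -
  have "v \<bullet> \<alpha> = - 1 \<Longrightarrow> v + \<alpha> \<in> weights"
    using weight_diff_weight[of v "- \<alpha>"] assms uminus_root by simp
  with weight_inner_root[OF assms(2,1)] weight_diff_weight[OF assms(2,1)] assms
  show ?thesis by (auto simp: root_refl_root)
qed

section \<open>Existence of neighbours and common neighbours\<close>

lemma ex_notin:
  fixes S :: "8 set"
  assumes "card S < 8"
  obtains m where "m \<notin> S"
proof -
  have "S \<noteq> UNIV" using assms by auto
  with that show thesis by blast
qed

lemma ex_adjacent:
  assumes "v \<in> weights"
  obtains w where "w \<in> weights" "v \<bullet> w = 1 / 2"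
proof -
  have *: "\<exists>w\<in>weights. wt i j \<bullet> w = 1 / 2" if "i \<noteq> j" for i j
  proof -
    have "card {i, j} < 8" using card_insert_le_m1[of 2 "{j}" i] by simp
    then obtain k where "k \<notin> {i, j}" by (rule ex_notin)
    with that show ?thesis by (intro bexI[of _ "wt i k"]) (auto simp: wt_inner_wt)
  qed
  from assms show thesis
  proof (cases rule: weight_cases)
    case (pos i j)
    with * that show thesis by blast
  next
    case (neg i j)
    from *[OF neg(1)] obtain w where "w \<in> weights" "wt i j \<bullet> w = 1 / 2" by blast
    with neg that[of "- w"] show thesis by simp
  qed
qed

lemma ex_common_neighbour:
  assumes "v \<in> weights" "w \<in> weights" "v \<bullet> w = - 1 / 2"
  obtains x where "x \<in> weights" "v \<bullet> x = 1 / 2" "w \<bullet> x = 1 / 2"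
proof -
  have pp: "\<exists>x\<in>weights. wt i j \<bullet> x = 1 / 2 \<and> wt k l \<bullet> x = 1 / 2"
    if "i \<noteq> j" "k \<noteq> l" "wt i j \<bullet> wt k l = - 1 / 2" for i j k l
  proof -
    have "distinct [i, j, k, l]"
      using that by (auto simp: wt_inner_wt of_bool_def split: if_splits)
    then show ?thesis by (intro bexI[of _ "wt i k"]) (auto simp: wt_inner_wt)
  qed
  have pn: "\<exists>x\<in>weights. wt i j \<bullet> x = 1 / 2 \<and> - wt k l \<bullet> x = 1 / 2"
    if ne: "i \<noteq> j" "k \<noteq> l" and eq: "wt i j \<bullet> - wt k l = - 1 / 2" for i j k l
  proof -
    obtain a b c where abc: "distinct [a, b, c]" "wt i j = wt a b" "wt k l = wt a c"
    proof -
      have "(i = k \<and> j \<noteq> l) \<or> (i = l \<and> j \<noteq> k) \<or> (j = k \<and> i \<noteq> l) \<or> (j = l \<and> i \<noteq> k)"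
        using ne eq by (auto simp: wt_inner_wt of_bool_def split: if_splits)
      then show thesis
        using that[of i j l] that[of i j k] that[of j i l] that[of j i k] ne
          wt_commute[of i j] wt_commute[of k l]
        by (elim disjE conjE) simp_all
    qed
    \<comment> \<open>For \<open>wt a b\<close> and \<open>- wt a c\<close> the common neighbour is
      \<open>wt b m\<close> with a fresh index \<open>m\<close>: it shares only \<open>b\<close>
      with the first pair and nothing with the second.\<close>
    have "card {a, b, c} < 8" using abc by simp
    then obtain m where m: "m \<notin> {a, b, c}" by (rule ex_notin)
    then have "wt a b \<bullet> wt b m = 1 / 2" "wt a c \<bullet> wt b m = - 1 / 2" "wt b m \<in> weights"
      using abc(1) by (auto simp: wt_inner_wt)
    then show ?thesis unfolding abc(2,3) by (intro bexI[of _ "wt b m"]) simp_all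
  qed
  from assms show thesis
  proof (elim weight_cases)
    fix i j k l assume *: "i \<noteq> j" "v = wt i j" "k \<noteq> l" "w = wt k l"
    with assms pp that show thesis by metis
  next
    fix i j k l assume *: "i \<noteq> j" "v = wt i j" "k \<noteq> l" "w = - wt k l"
    with assms pn[of i j k l] that show thesis by metis
  next
    fix i j k l assume *: "i \<noteq> j" "v = - wt i j" "k \<noteq> l" "w = wt k l"
    with assms pn[of k l i j] that show thesis by (metis inner_commute)
  next
    fix i j k l assume *: "i \<noteq> j" "v = - wt i j" "k \<noteq> l" "w = - wt k l"
    with assms pp[of i j k l] obtain x where "x \<in> weights" "wt i j \<bullet> x = 1 / 2" "wt k l \<bullet> x = 1 / 2"
      by auto
    with * that[of "- x"] show thesis by simp
  qed
qed

section \<open>The orbit of the base point\<close>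

lemma UNIV_8: "(UNIV :: 8 set) = {1, 2, 3, 4, 5, 6, 7, 8}"
proof -
  have "card {1, 2, 3, 4, 5, 6, 7, 8 :: 8} = 8" by simp
  then show ?thesis using card_subset_eq[of "UNIV :: 8 set" "{1, 2, 3, 4, 5, 6, 7, 8}"] by simp
qed

lemma root_refl_scaleR: "root_refl \<alpha> (c *\<^sub>R x) = c *\<^sub>R root_refl \<alpha> x"
  by (simp add: root_refl_def scaleR_diff_right)

lemma root_refl_in_refl_group: "\<alpha> \<in> R \<Longrightarrow> root_refl \<alpha> \<in> refl_group R"
  using refl_group.step[OF _ refl_group.id, of \<alpha> R] by simp

lemma refl_group_fixes:
  assumes "w \<in> refl_group R" "\<And>\<alpha>. \<alpha> \<in> R \<Longrightarrow> x \<bullet> \<alpha> = 0"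
  shows "w x = x"
  using assms by induction (simp_all add: root_refl_def)

lemma simple_roots:
  "E7_simple_root 1 = axis 1 1 - axis 2 1" "E7_simple_root 2 = half_sign_vec {4, 5, 6, 7}"
  "E7_simple_root 3 = axis 2 1 - axis 3 1" "E7_simple_root 4 = axis 3 1 - axis 4 1"
  "E7_simple_root 5 = axis 4 1 - axis 5 1" "E7_simple_root 6 = axis 5 1 - axis 6 1"
  by (simp_all add: E7_simple_root_def)

lemma simple_image: "E7_simple_root ` {1..6} = {axis 1 1 - axis 2 1, half_sign_vec {4, 5, 6, 7},
  axis 2 1 - axis 3 1, axis 3 1 - axis 4 1, axis 4 1 - axis 5 1, axis 5 1 - axis 6 1}"
proof -
  have "{1..6} = {1, 2, 3, 4, 5, 6 :: nat}" by auto
  then show ?thesis by (simp only: image_insert image_empty simple_roots)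
qed

lemma P7_fixes_wt: "w \<in> P7 \<Longrightarrow> w (wt 7 8) = wt 7 8"
  unfolding P7_def
proof (erule refl_group_fixes)
  have "half_sign_vec {4, 5, 6, 7} \<bullet> wt 7 8 = 0"
    by (subst half_inner_wt) simp_all
  then show "wt 7 8 \<bullet> \<alpha> = 0" if "\<alpha> \<in> E7_simple_root ` {1..6}" for \<alpha>
    using that unfolding simple_image
    by (auto simp: inner_commute[of "wt _ _"] axis_diff_inner_wt)
qed

lemma span_roots_sum:
  assumes "p \<in> span E7_roots"
  shows "(\<Sum>i\<in>UNIV. p $ i) = 0"
  using assms
proof (induction rule: span_induct_alt)
  case (step c x y)
  have "(\<Sum>i\<in>UNIV. x $ i) = 0"
    using step(1)
    by (rule root_cases)
      (use sum_half_sign_vec in \<open>auto simp: sum_subtractf axis_def\<close>)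
  with step show ?case
    by (simp add: sum.distrib flip: sum_distrib_left)
qed simp

text \<open>Being fixed by the six simple reflections means orthogonality to six independent roots
  of a space of dimension 7, which leaves the line through \<open>wt 7 8\<close>.\<close>

lemma point_with_stabilizer_P7:
  assumes "p \<in> span E7_roots" "stabilizer_E7 p = P7"
  obtains c where "c \<noteq> 0" "p = c *\<^sub>R wt 7 8"
proof -
  have "\<forall>\<alpha> \<in> E7_simple_root ` {1..6}. p \<bullet> \<alpha> = 0"
  proof
    fix \<alpha> assume that: "\<alpha> \<in> E7_simple_root ` {1..6}"
    have "root_refl \<alpha> \<in> stabilizer_E7 p"
      unfolding assms(2) P7_def using that by (rule root_refl_in_refl_group)
    then have "root_refl \<alpha> p = p" by (simp add: stabilizer_E7_def)
    then show "p \<bullet> \<alpha> = 0" by (auto simp: root_refl_def)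
  qed
  then have *: "p $ 1 = p $ 2" "p $ 2 = p $ 3" "p $ 3 = p $ 4" "p $ 4 = p $ 5" "p $ 5 = p $ 6"
    "p \<bullet> half_sign_vec {4, 5, 6, 7} = 0"
    unfolding simple_image by (simp_all add: inner_diff_right inner_axis)
  have sum: "p $ 1 + p $ 2 + p $ 3 + p $ 4 + p $ 5 + p $ 6 + p $ 7 + p $ 8 = 0"
    using span_roots_sum[OF assms(1)] unfolding UNIV_8 by simp
  have "p $ 4 + p $ 5 + p $ 6 + p $ 7 = p $ 1 + p $ 2 + p $ 3 + p $ 8"
    using *(6) unfolding inner_vec_def UNIV_8 by (simp add: half_sign_vec_nth)
  \<comment> \<open>The first coordinate of \<open>wt 7 8\<close> is -1/4, which dictates the
    factor.\<close>
  moreover define c where "c = - 4 * p $ 1"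
  ultimately have eqs: "p $ 1 = - c / 4" "p $ 2 = - c / 4" "p $ 3 = - c / 4" "p $ 4 = - c / 4"
    "p $ 5 = - c / 4" "p $ 6 = - c / 4" "p $ 7 = 3 * c / 4" "p $ 8 = 3 * c / 4"
    using sum *(1-5) by linarith+
  have "\<forall>i\<in>UNIV. p $ i = (c *\<^sub>R wt 7 8) $ i"
    unfolding UNIV_8 by (simp add: wt_nth eqs)
  then have p: "p = c *\<^sub>R wt 7 8"
    by (simp add: vec_eq_iff)
  moreover have "c \<noteq> 0"
  proof
    assume "c = 0"
    with p have "p = 0" by simp
    \<comment> \<open>This is the seventh simple root. Its reflection would fix the origin but moves
      \<open>wt 7 8\<close>, which all of \<open>P7\<close> fixes.\<close>
    have root: "axis 6 1 - axis 7 1 \<in> E7_roots" by (rule axis_diff_root) simp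
    then have "root_refl (axis 6 1 - axis 7 1) \<in> stabilizer_E7 p"
      using root_refl_in_refl_group \<open>p = 0\<close> by (auto simp: stabilizer_E7_def W_E7_def root_refl_def)
    then have "root_refl (axis 6 1 - axis 7 1) (wt 7 8) = wt 7 8"
      using P7_fixes_wt assms(2) by simp
    moreover have "wt 7 8 \<bullet> (axis 6 1 - axis 7 1) = - 1"
      by (auto simp: inner_commute[of "wt _ _"] axis_diff_inner_wt)
    ultimately have "axis 6 1 - axis 7 1 = (0 :: real ^ 8)"
      using root_refl_root[OF root] by simp
    with root root_inner_self show False by fastforce
  qed
  ultimately show thesis using that by blast
qed

lemma root_refl_adjacent:
  assumes "v \<in> weights" "w \<in> weights" "v \<bullet> w = 1 / 2"
  shows "root_refl (v - w) v = w" "root_refl (v - w) w = v"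
proof -
  have "v \<bullet> (v - w) = 1" "w \<bullet> (v - w) = - 1"
    using assms by (simp_all add: inner_diff_right weight_inner_self inner_commute[of w v])
  then show "root_refl (v - w) v = w" "root_refl (v - w) w = v"
    by (simp_all add: root_refl_root[OF weight_diff_root[OF assms]])
qed

text \<open>Reflections permute the weights, which bounds the orbit. Conversely a reflection carries
  a weight to any neighbour, a common neighbour leads on to distance 2, and the antipode is at
  distance 2 from every neighbour.\<close>

lemma verts_321_scaled: "verts_321 (c *\<^sub>R wt 7 8) = (*\<^sub>R) c ` weights"
proof
  have "w (c *\<^sub>R wt 7 8) \<in> (*\<^sub>R) c ` weights" if "w \<in> W_E7" for w
    using that unfolding W_E7_def
  proof induction
    case (step \<alpha> w)
    then obtain v where "v \<in> weights" "w (c *\<^sub>R wt 7 8) = c *\<^sub>R v" by auto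
    with step root_refl_weight show ?case by (auto simp: root_refl_scaleR)
  qed auto
  then show "verts_321 (c *\<^sub>R wt 7 8) \<subseteq> (*\<^sub>R) c ` weights"
    by (auto simp: verts_321_def)
next
  let ?O = "{v. c *\<^sub>R v \<in> verts_321 (c *\<^sub>R wt 7 8)}"
  have base: "wt 7 8 \<in> ?O"
    using imageI[OF refl_group.id, of "\<lambda>w. w (c *\<^sub>R wt 7 8)"]
    by (simp add: verts_321_def W_E7_def)
  have adj: "w \<in> ?O" if "v \<in> ?O" "v \<in> weights" "w \<in> weights" "v \<bullet> w = 1 / 2" for v w
  proof -
    have root: "v - w \<in> E7_roots" using that weight_diff_root by blast
    from that(1) obtain g where "g \<in> W_E7" "c *\<^sub>R v = g (c *\<^sub>R wt 7 8)"
      unfolding verts_321_def by blast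
    then have "c *\<^sub>R w = (root_refl (v - w) \<circ> g) (c *\<^sub>R wt 7 8)"
      using root_refl_adjacent(1)[OF that(2-)] root_refl_scaleR[of "v - w" c v] by simp
    moreover have "root_refl (v - w) \<circ> g \<in> W_E7"
      using refl_group.step[OF root] \<open>g \<in> W_E7\<close> unfolding W_E7_def by blast
    ultimately show ?thesis unfolding verts_321_def by blast
  qed
  have dist2: "w \<in> ?O" if "v \<in> ?O" "v \<in> weights" "w \<in> weights" "v \<bullet> w = - 1 / 2" for v w
    using ex_common_neighbour[OF that(2-)] adj[OF that(1,2)] adj[OF _ _ that(3)]
    by (metis inner_commute)
  have "w \<in> ?O" if "w \<in> weights" for w
  proof -
    have wt: "wt 7 8 \<in> weights" by simp
    from weight_inner_weight[OF wt that]
    consider "wt 7 8 \<bullet> w = 3 / 2" | "wt 7 8 \<bullet> w = 1 / 2" | "wt 7 8 \<bullet> w = - 1 / 2"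
      | "wt 7 8 \<bullet> w = - 3 / 2" by auto
    then show ?thesis
    proof cases
      case 1
      then show ?thesis using weight_eqI[OF wt that] base by simp
    next
      case 2
      then show ?thesis using adj base wt that by blast
    next
      case 3
      then show ?thesis using dist2 base wt that by blast
    next
      case 4
      then have w: "w = - wt 7 8" using weight_eqI[of "wt 7 8" "- w"] wt that by simp
      obtain x where x: "x \<in> weights" "wt 7 8 \<bullet> x = 1 / 2" using ex_adjacent[OF wt] .
      then have "x \<in> ?O" using adj base wt by blast
      then show ?thesis using dist2[OF _ x(1) that] x w by (simp add: inner_commute)
    qed
  qed
  then show "(*\<^sub>R) c ` weights \<subseteq> verts_321 (c *\<^sub>R wt 7 8)" by auto
qed

section \<open>Faces of the polytope\<close>

lemma face_of_convex_hull_max: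
  fixes S :: "'a::euclidean_space set"
  assumes "finite S" "\<And>x. x \<in> S \<Longrightarrow> a \<bullet> x \<le> t"
  shows "convex hull S \<inter> {x. a \<bullet> x = t} = convex hull {x \<in> S. a \<bullet> x = t}"
    and "convex hull {x \<in> S. a \<bullet> x = t} face_of convex hull S"
proof -
  have "convex hull S \<subseteq> {x. a \<bullet> x \<le> t}"
    using assms(2) by (intro hull_minimal convex_halfspace_le) auto
  then have face: "convex hull S \<inter> {x. a \<bullet> x = t} face_of convex hull S"
    by (intro face_of_Int_supporting_hyperplane_le) auto
  then obtain S' where S': "S' \<subseteq> S" "convex hull S \<inter> {x. a \<bullet> x = t} = convex hull S'"
    using face_of_convex_hull_subset[OF finite_imp_compact[OF assms(1)]] by blast
  then have "S' \<subseteq> {x \<in> S. a \<bullet> x = t}" using hull_subset[of S' convex] by blast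
  moreover have "convex hull {x \<in> S. a \<bullet> x = t} \<subseteq> convex hull S \<inter> {x. a \<bullet> x = t}"
    by (intro hull_minimal convex_Int convex_hyperplane) (auto simp: hull_inc)
  ultimately show eq: "convex hull S \<inter> {x. a \<bullet> x = t} = convex hull {x \<in> S. a \<bullet> x = t}"
    using S'(2) hull_mono by blast
  from face show "convex hull {x \<in> S. a \<bullet> x = t} face_of convex hull S" unfolding eq .
qed

text \<open>The two segments share their midpoint, and a face containing a point in the interior of
  a segment of \<open>S\<close> contains its ends. This is what forces vertices into a face.\<close>

lemma face_of_diagonal:
  fixes S :: "'a::euclidean_space set"
  assumes "F face_of S" "a \<in> F" "b \<in> F" "x \<in> S" "y \<in> S" "a + b = x + y"
  shows "x \<in> F"
proof -
  have mid: "midpoint x y = midpoint a b" using assms(6) by (simp add: midpoint_def)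
  have "midpoint a b \<in> F"
    using closed_segment_subset[OF assms(2,3) face_of_imp_convex[OF assms(1)]] by auto
  with mid have "midpoint x y \<in> F" by simp
  then show ?thesis
    using face_ofD[OF assms(1) _ assms(4,5), of "midpoint x y"] by (cases "x = y") (auto simp: midpoint_in_open_segment)
qed

text \<open>The scale \<open>c\<close> may be negative, so functionals are rescaled by
  \<open>inverse c\<close> and the inequalities between weights keep their direction.\<close>

lemma inverse_mult_cancel: "c \<noteq> 0 \<Longrightarrow> inverse c * (c * t) = (t :: real)"
  by (simp add: field_simps)

lemma finite_weights: "finite weights"
proof -
  have "weights \<subseteq> (\<lambda>(i, j). wt i j) ` UNIV \<union> (\<lambda>(i, j). - wt i j) ` UNIV"
    by (auto simp: weights_def)
  then show ?thesis by (rule finite_subset) simp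
qed

text \<open>The functional given by \<open>v\<close> is 3/2 at \<open>v\<close> and at most 1/2 at
  every other weight. Hence the weights are in convex position and a hull determines the set of
  weights that it comes from.\<close>

lemma weight_in_hull_iff:
  assumes "c \<noteq> 0" "K \<subseteq> weights" "v \<in> weights"
  shows "c *\<^sub>R v \<in> convex hull ((*\<^sub>R) c ` K) \<longleftrightarrow> v \<in> K"
proof
  assume hull: "c *\<^sub>R v \<in> convex hull ((*\<^sub>R) c ` K)"
  show "v \<in> K"
  proof (rule ccontr)
    assume "v \<notin> K"
    have "v \<bullet> x \<le> 1 / 2" if "x \<in> K" for x
      using weight_inner_weight[OF assms(3), of x] weight_eqI[OF assms(3), of x] that assms(2) \<open>v \<notin> K\<close>
      by fastforce
    then have "convex hull ((*\<^sub>R) c ` K) \<subseteq> {x. (inverse c *\<^sub>R v) \<bullet> x \<le> 1 / 2}"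
      using assms(1) by (intro hull_minimal convex_halfspace_le) (auto simp: inverse_mult_cancel)
    with hull have "(inverse c *\<^sub>R v) \<bullet> (c *\<^sub>R v) \<le> 1 / 2" by blast
    with assms(1,3) show False by (simp add: weight_inner_self)
  qed
next
  assume "v \<in> K"
  then show "c *\<^sub>R v \<in> convex hull ((*\<^sub>R) c ` K)" by (intro hull_inc imageI)
qed

lemma weight_pair_inner:
  assumes "x \<in> weights" "y \<in> weights" "x + y \<in> E7_roots"
  shows "x \<bullet> y = - 1 / 2" "x \<bullet> (x + y) = 1" "y \<bullet> (x + y) = 1"
proof -
  have "(x + y) \<bullet> (x + y) = 2" by (rule root_inner_self[OF assms(3)])
  with assms(1,2) show *: "x \<bullet> y = - 1 / 2"
    by (simp add: inner_add_left inner_add_right weight_inner_self inner_commute[of y x])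
  with assms(1,2) show "x \<bullet> (x + y) = 1" "y \<bullet> (x + y) = 1"
    by (simp_all add: inner_add_right weight_inner_self inner_commute[of y x])
qed

text \<open>This is the vertex antipodal to \<open>x\<close> in the cross-polytope of the root
  \<open>v + w\<close>.\<close>

lemma opposite_weight:
  assumes "v \<in> weights" "w \<in> weights" "x \<in> weights" "v \<bullet> w = - 1 / 2" "x \<bullet> (v + w) = 1"
  shows "v + w - x \<in> weights"
proof -
  have "v - (- w) \<in> E7_roots" using assms by (intro weight_diff_root) simp_all
  then have "x - (v + w) \<in> weights" using assms by (intro weight_diff_weight) simp_all
  then have "- (x - (v + w)) \<in> weights" by (simp only: uminus_in_weights)
  then show ?thesis by simp
qed

text \<open>Distinct non-neighbours are a diagonal whose midpoint is also that of another pair of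
  weights, so no edge joins them. For neighbours the functional \<open>v + w\<close> exposes the
  edge.\<close>

lemma edge_of_weights:
  assumes "c \<noteq> 0" "v \<in> weights" "w \<in> weights"
  shows "closed_segment (c *\<^sub>R v) (c *\<^sub>R w) edge_of convex hull ((*\<^sub>R) c ` weights) \<longleftrightarrow> v \<bullet> w = 1 / 2"
    (is "?S edge_of ?P \<longleftrightarrow> _")
proof
  assume edge: "?S edge_of ?P"
  then have "v \<noteq> w" by (auto simp: edge_of_def)
  have no_diag: "x \<in> {v, w}" if "x \<in> weights" "y \<in> weights" "v + w = x + y" for x y
  proof -
    have "c *\<^sub>R v + c *\<^sub>R w = c *\<^sub>R x + c *\<^sub>R y" using that(3) by (simp flip: scaleR_add_right)
    moreover have "?S face_of ?P" using edge by (simp add: edge_of_def)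
    moreover have "c *\<^sub>R x \<in> ?P" "c *\<^sub>R y \<in> ?P" using that by (auto intro!: hull_inc)
    ultimately have "c *\<^sub>R x \<in> ?S"
      using face_of_diagonal[of ?S ?P "c *\<^sub>R v" "c *\<^sub>R w" "c *\<^sub>R x" "c *\<^sub>R y"] by simp
    then have "c *\<^sub>R x \<in> convex hull ((*\<^sub>R) c ` {v, w})" by (simp add: segment_convex_hull)
    then show ?thesis using weight_in_hull_iff[of c "{v, w}" x] assms that by blast
  qed
  show "v \<bullet> w = 1 / 2"
  proof (rule ccontr)
    assume "v \<bullet> w \<noteq> 1 / 2"
    with weight_inner_weight[OF assms(2,3)] weight_eqI[OF assms(2,3)] \<open>v \<noteq> w\<close>
    consider "v \<bullet> w = - 1 / 2" | "v \<bullet> w = - 3 / 2" by auto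
    then show False
    proof cases
      case 1
      obtain x where x: "x \<in> weights" "v \<bullet> x = 1 / 2" "w \<bullet> x = 1 / 2"
        using ex_common_neighbour[OF assms(2,3) 1] .
      then have "v + w - x \<in> weights"
        using opposite_weight[OF assms(2,3) x(1) 1] by (simp add: inner_add_right inner_commute)
      with no_diag[of x "v + w - x"] x have "x \<in> {v, w}" by simp
      with x assms show False by (auto simp: weight_inner_self)
    next
      case 2
      then have "w = - v" using weight_eqI[of v "- w"] assms by simp
      obtain x where x: "x \<in> weights" "v \<bullet> x = 1 / 2" using ex_adjacent[OF assms(2)] .
      with no_diag[of x "- x"] \<open>w = - v\<close> have "x \<in> {v, - v}" by simp
      with x assms show False by (auto simp: weight_inner_self)
    qed
  qed
next
  assume vw: "v \<bullet> w = 1 / 2"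
  let ?a = "inverse c *\<^sub>R (v + w)"
  \<comment> \<open>At the two ends the value is 3/2 + 1/2; any other weight contributes at most 1/2
    twice.\<close>
  have le: "(v + w) \<bullet> x \<le> 2" "(v + w) \<bullet> x = 2 \<longleftrightarrow> x = v \<or> x = w" if "x \<in> weights" for x
  proof -
    have "v \<bullet> x \<le> 1 / 2 \<or> x = v" "w \<bullet> x \<le> 1 / 2 \<or> x = w"
      using weight_inner_weight[OF assms(2) that] weight_inner_weight[OF assms(3) that]
        weight_eqI[OF assms(2) that] weight_eqI[OF assms(3) that] by auto
    then show "(v + w) \<bullet> x \<le> 2" "(v + w) \<bullet> x = 2 \<longleftrightarrow> x = v \<or> x = w"
      using vw assms by (auto simp: inner_add_left weight_inner_self inner_commute[of w v])
  qed
  have "{x \<in> (*\<^sub>R) c ` weights. ?a \<bullet> x = 2} = {c *\<^sub>R v, c *\<^sub>R w}"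
    using assms le(2) by (auto simp: inverse_mult_cancel)
  moreover have "convex hull {x \<in> (*\<^sub>R) c ` weights. ?a \<bullet> x = 2} face_of ?P"
    using assms(1) finite_weights le(1) by (intro face_of_convex_hull_max(2)) (auto simp: inverse_mult_cancel)
  ultimately have "?S face_of ?P" by (simp add: segment_convex_hull)
  moreover have "v \<noteq> w" using vw assms by (auto simp: weight_inner_self)
  then have "aff_dim ?S = 1"
    using assms(1) by (simp add: segment_convex_hull aff_dim_convex_hull aff_dim_2)
  ultimately show "?S edge_of ?P" by (simp add: edge_of_def)
qed

section \<open>Edge distance, spanned faces and monomials in terms of weights\<close>

context
  fixes p :: "real ^ 8" and c :: real
  assumes c: "c \<noteq> 0" and p: "p = c *\<^sub>R wt 7 8"
begin

lemma verts_p: "verts_321 p = (*\<^sub>R) c ` weights"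
  unfolding p by (rule verts_321_scaled)

lemma poly_p: "poly_321 p = convex hull ((*\<^sub>R) c ` weights)"
  by (simp add: poly_321_def Delta_def verts_p)

lemma edge_rel_p: "v \<in> weights \<Longrightarrow> w \<in> weights \<Longrightarrow>
    (c *\<^sub>R v, c *\<^sub>R w) \<in> edge_rel_321 p \<longleftrightarrow> v \<bullet> w = 1 / 2"
  using edge_of_weights[OF c] by (auto simp: edge_rel_321_def verts_p poly_p)

text \<open>Equality and adjacency are excluded by the smaller distances, and antipodes have no
  common neighbour, since a neighbour of \<open>v\<close> has inner product -1/2 with
  \<open>- v\<close>. Only the value -1/2 is left.\<close>

lemma at_edge_distance_2_p:
  "at_edge_distance_321 p 2 A B \<longleftrightarrow>
    (\<exists>v\<in>weights. \<exists>w\<in>weights. A = c *\<^sub>R v \<and> B = c *\<^sub>R w \<and> v \<bullet> w = - 1 / 2)"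
proof -
  have rel2: "edge_rel_321 p ^^ 2 = edge_rel_321 p O edge_rel_321 p"
    by (simp add: numeral_2_eq_2)
  have m: "(\<forall>m<2. Q m) \<longleftrightarrow> Q 0 \<and> Q (1 :: nat)" for Q
    by (auto simp: numeral_2_eq_2 less_Suc_eq)
  have dist2: "(c *\<^sub>R v, c *\<^sub>R w) \<in> edge_rel_321 p O edge_rel_321 p \<and> v \<noteq> w \<and> v \<bullet> w \<noteq> 1 / 2
      \<longleftrightarrow> v \<bullet> w = - 1 / 2" if vw: "v \<in> weights" "w \<in> weights" for v w
  proof
    assume *: "(c *\<^sub>R v, c *\<^sub>R w) \<in> edge_rel_321 p O edge_rel_321 p \<and> v \<noteq> w \<and> v \<bullet> w \<noteq> 1 / 2"
    then obtain X where "(c *\<^sub>R v, X) \<in> edge_rel_321 p" "(X, c *\<^sub>R w) \<in> edge_rel_321 p" by blast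
    moreover from this obtain x where x: "X = c *\<^sub>R x" "x \<in> weights"
      by (auto simp: edge_rel_321_def verts_p)
    ultimately have "v \<bullet> x = 1 / 2" "x \<bullet> w = 1 / 2" using edge_rel_p vw by auto
    then have "w \<noteq> - v" by (auto simp: inner_commute)
    with weight_eqI[of v "- w"] vw have "v \<bullet> w \<noteq> - 3 / 2" by auto
    with weight_inner_weight[OF vw] weight_eqI[OF vw] * show "v \<bullet> w = - 1 / 2" by auto
  next
    assume *: "v \<bullet> w = - 1 / 2"
    obtain x where "x \<in> weights" "v \<bullet> x = 1 / 2" "w \<bullet> x = 1 / 2"
      using ex_common_neighbour[OF vw *] .
    then have "(c *\<^sub>R v, c *\<^sub>R x) \<in> edge_rel_321 p" "(c *\<^sub>R x, c *\<^sub>R w) \<in> edge_rel_321 p"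
      using edge_rel_p vw by (auto simp: inner_commute)
    with * vw show "(c *\<^sub>R v, c *\<^sub>R w) \<in> edge_rel_321 p O edge_rel_321 p \<and> v \<noteq> w \<and> v \<bullet> w \<noteq> 1 / 2"
      by (auto simp: weight_inner_self)
  qed
  have iff: "at_edge_distance_321 p 2 (c *\<^sub>R v) (c *\<^sub>R w) \<longleftrightarrow> v \<bullet> w = - 1 / 2"
    if vw: "v \<in> weights" "w \<in> weights" for v w
    using dist2[OF vw] edge_rel_p[OF vw] vw c
    by (simp add: at_edge_distance_321_def rel2 m verts_p)
  show ?thesis
  proof
    assume dist: "at_edge_distance_321 p 2 A B"
    then obtain v w where "v \<in> weights" "w \<in> weights" "A = c *\<^sub>R v" "B = c *\<^sub>R w"
      by (auto simp: at_edge_distance_321_def verts_p)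
    with dist iff show "\<exists>v\<in>weights. \<exists>w\<in>weights. A = c *\<^sub>R v \<and> B = c *\<^sub>R w \<and> v \<bullet> w = - 1 / 2"
      by blast
  next
    assume "\<exists>v\<in>weights. \<exists>w\<in>weights. A = c *\<^sub>R v \<and> B = c *\<^sub>R w \<and> v \<bullet> w = - 1 / 2"
    with iff show "at_edge_distance_321 p 2 A B" by blast
  qed
qed

text \<open>The root \<open>v + w\<close> is at most 1 on the weights, so its level 1 is a face
  through both points and bounds the spanned face from above. Every weight on that level belongs to
  a diagonal with the same midpoint and so lies in each face containing the two points.\<close>

lemma spanned_face_p:
  assumes vw: "v \<in> weights" "w \<in> weights" "v \<bullet> w = - 1 / 2" and x: "x \<in> weights"
  shows "c *\<^sub>R x \<in> spanned_face_321 p (c *\<^sub>R v) (c *\<^sub>R w) \<longleftrightarrow> x \<bullet> (v + w) = 1"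
proof
  let ?a = "inverse c *\<^sub>R (v + w)"
  let ?F = "convex hull {x \<in> (*\<^sub>R) c ` weights. ?a \<bullet> x = 1}"
  have root: "v + w \<in> E7_roots" using weight_diff_root[of v "- w"] vw by simp
  have "y \<bullet> (v + w) \<le> 1" if "y \<in> weights" for y
    using weight_inner_root[OF that root] by auto
  then have le: "?a \<bullet> y \<le> 1" if "y \<in> (*\<^sub>R) c ` weights" for y
    using that c by (auto simp: inner_commute inverse_mult_cancel)
  have face: "?F face_of poly_321 p" unfolding poly_p
    using le finite_weights by (intro face_of_convex_hull_max(2)) auto
  have "v \<bullet> (v + w) = 1" "w \<bullet> (v + w) = 1"
    using vw by (simp_all add: inner_add_right weight_inner_self inner_commute[of w v])
  then have "c *\<^sub>R v \<in> ?F" "c *\<^sub>R w \<in> ?F"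
    using vw c by (auto intro!: hull_inc simp: inner_commute[of "v + w"] inverse_mult_cancel)
  moreover assume "c *\<^sub>R x \<in> spanned_face_321 p (c *\<^sub>R v) (c *\<^sub>R w)"
  ultimately have "c *\<^sub>R x \<in> ?F" using face by (auto simp: spanned_face_321_def)
  moreover have "?F \<subseteq> {y. ?a \<bullet> y = 1}" by (intro hull_minimal convex_hyperplane) auto
  ultimately have "?a \<bullet> (c *\<^sub>R x) = 1" by blast
  then show "x \<bullet> (v + w) = 1" using c by (simp add: inner_commute inverse_mult_cancel)
next
  assume "x \<bullet> (v + w) = 1"
  then have y: "v + w - x \<in> weights" using opposite_weight vw x by blast
  have "c *\<^sub>R v + c *\<^sub>R w = c *\<^sub>R x + c *\<^sub>R (v + w - x)" by (simp flip: scaleR_add_right)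
  moreover have "c *\<^sub>R x \<in> poly_321 p" "c *\<^sub>R (v + w - x) \<in> poly_321 p"
    unfolding poly_p using x y by (auto intro!: hull_inc simp del: scaleR_diff_right)
  ultimately have "c *\<^sub>R x \<in> F" if "F face_of poly_321 p" "c *\<^sub>R v \<in> F" "c *\<^sub>R w \<in> F" for F
    using face_of_diagonal[OF that] by blast
  then show "c *\<^sub>R x \<in> spanned_face_321 p (c *\<^sub>R v) (c *\<^sub>R w)"
    by (auto simp: spanned_face_321_def)
qed

text \<open>Equal midpoints mean equal sums, and a pair of weights with the root as sum lies on its
  level 1, hence in the spanned face.\<close>

lemma f_E7_p:
  assumes vw: "v \<in> weights" "w \<in> weights" "v \<bullet> w = - 1 / 2"
  shows "f_E7 p (c *\<^sub>R v) (c *\<^sub>R w) =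
    {{c *\<^sub>R x, c *\<^sub>R y} | x y. x \<in> weights \<and> y \<in> weights \<and> x + y = v + w}"
proof -
  have root: "v + w \<in> E7_roots" using weight_diff_root[of v "- w"] vw by simp
  have face: "c *\<^sub>R x \<in> spanned_face_321 p (c *\<^sub>R v) (c *\<^sub>R w) \<and> c *\<^sub>R y \<in> spanned_face_321 p (c *\<^sub>R v) (c *\<^sub>R w)"
    if "x \<in> weights" "y \<in> weights" "x + y = v + w" for x y
    using spanned_face_p[OF vw] weight_pair_inner[of x y] root that by simp
  have mid: "midpoint (c *\<^sub>R x) (c *\<^sub>R y) = midpoint (c *\<^sub>R v) (c *\<^sub>R w) \<longleftrightarrow> x + y = v + w" for x y
    using c by (simp add: midpoint_def flip: scaleR_add_right)
  show ?thesis
  proof (intro equalityI subsetI)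
    fix m assume "m \<in> f_E7 p (c *\<^sub>R v) (c *\<^sub>R w)"
    then obtain x y where "m = {c *\<^sub>R x, c *\<^sub>R y}" "x \<in> weights" "y \<in> weights"
      "midpoint (c *\<^sub>R x) (c *\<^sub>R y) = midpoint (c *\<^sub>R v) (c *\<^sub>R w)"
      unfolding f_E7_def verts_p by blast
    then show "m \<in> {{c *\<^sub>R x, c *\<^sub>R y} | x y. x \<in> weights \<and> y \<in> weights \<and> x + y = v + w}"
      using mid by blast
  next
    fix m assume "m \<in> {{c *\<^sub>R x, c *\<^sub>R y} | x y. x \<in> weights \<and> y \<in> weights \<and> x + y = v + w}"
    then obtain x y where "m = {c *\<^sub>R x, c *\<^sub>R y}" "x \<in> weights" "y \<in> weights" "x + y = v + w"
      by blast
    with face[of x y] mid[of x y] show "m \<in> f_E7 p (c *\<^sub>R v) (c *\<^sub>R w)"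
      unfolding f_E7_def verts_p by blast
  qed
qed

end

section \<open>Tropical conditions on the weights\<close>

text \<open>Each monomial is encoded by one of its members \<open>x\<close>, the other being
  \<open>\<alpha> - x\<close>; the two disequalities of \<open>y\<close> say that the monomials
  differ.\<close>

definition weight_trop :: "(real ^ 8 \<Rightarrow> real) \<Rightarrow> real ^ 8 \<Rightarrow> bool" where
  "weight_trop \<nu> \<alpha> \<longleftrightarrow> (\<exists>x\<in>weights. \<exists>y\<in>weights. \<alpha> - x \<in> weights \<and> \<alpha> - y \<in> weights \<and>
     y \<noteq> x \<and> y \<noteq> \<alpha> - x \<and> \<nu> x + \<nu> (\<alpha> - x) = \<nu> y + \<nu> (\<alpha> - y) \<and>
     (\<forall>z\<in>weights. \<alpha> - z \<in> weights \<longrightarrow> \<nu> x + \<nu> (\<alpha> - x) \<le> \<nu> z + \<nu> (\<alpha> - z)))"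

text \<open>Of two distinct minimal monomials at least one differs from the given one. Every
  monomial thus has a rival of no larger value.\<close>

lemma weight_trop_other:
  assumes "weight_trop \<nu> \<alpha>" "x \<in> weights" "\<alpha> - x \<in> weights"
  obtains y where "y \<in> weights" "\<alpha> - y \<in> weights" "y \<noteq> x" "y \<noteq> \<alpha> - x"
    "\<nu> y + \<nu> (\<alpha> - y) \<le> \<nu> x + \<nu> (\<alpha> - x)"
proof -
  obtain y z where yz: "y \<in> weights" "z \<in> weights" "\<alpha> - y \<in> weights" "\<alpha> - z \<in> weights"
    "z \<noteq> y" "z \<noteq> \<alpha> - y" "\<nu> y + \<nu> (\<alpha> - y) = \<nu> z + \<nu> (\<alpha> - z)"
    "\<nu> y + \<nu> (\<alpha> - y) \<le> \<nu> x + \<nu> (\<alpha> - x)"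
    using assms unfolding weight_trop_def by blast
  show thesis
  proof (cases "y = x \<or> y = \<alpha> - x")
    case True
    with yz have "z \<noteq> x" "z \<noteq> \<alpha> - x" by auto
    with yz that[of z] show thesis by simp
  next
    case False
    with yz that[of y] show thesis by simp
  qed
qed

text \<open>The members of every monomial add up to \<alpha>, so all monomials are shifted by the
  same amount.\<close>

lemma weight_trop_add_linear:
  assumes "weight_trop \<nu> \<alpha>"
  shows "weight_trop (\<lambda>v. \<nu> v + a \<bullet> v + k) \<alpha>"
proof -
  have eq: "(\<nu> x + a \<bullet> x + k) + (\<nu> (\<alpha> - x) + a \<bullet> (\<alpha> - x) + k) = \<nu> x + \<nu> (\<alpha> - x) + (a \<bullet> \<alpha> + 2 * k)" for x
    by (simp add: inner_diff_right)
  show ?thesis using assms unfolding weight_trop_def eq by simp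
qed

lemma weight_trop_uminus:
  assumes "weight_trop \<nu> (- \<alpha>)"
  shows "weight_trop (\<lambda>v. \<nu> (- v)) \<alpha>"
proof -
  obtain x y where xy: "x \<in> weights" "y \<in> weights" "- \<alpha> - x \<in> weights" "- \<alpha> - y \<in> weights"
    "y \<noteq> x" "y \<noteq> - \<alpha> - x" "\<nu> x + \<nu> (- \<alpha> - x) = \<nu> y + \<nu> (- \<alpha> - y)"
    and min: "\<forall>z\<in>weights. - \<alpha> - z \<in> weights \<longrightarrow> \<nu> x + \<nu> (- \<alpha> - x) \<le> \<nu> z + \<nu> (- \<alpha> - z)"
    using assms unfolding weight_trop_def by blast
  have neg: "\<alpha> - - z = - (- \<alpha> - z)" "- (\<alpha> - z) = - \<alpha> - - z" for z by simp_all
  have in': "\<alpha> - - x \<in> weights" "\<alpha> - - y \<in> weights"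
    unfolding neg(1) using xy by (simp_all only: uminus_in_weights)
  have min': "\<nu> (- (- x)) + \<nu> (- (\<alpha> - - x)) \<le> \<nu> (- z) + \<nu> (- (\<alpha> - z))"
    if "z \<in> weights" "\<alpha> - z \<in> weights" for z
  proof -
    have "- z \<in> weights" "- \<alpha> - - z \<in> weights"
      using that unfolding neg(2)[symmetric] by (simp_all only: uminus_in_weights)
    with min have "\<nu> x + \<nu> (- \<alpha> - x) \<le> \<nu> (- z) + \<nu> (- \<alpha> - - z)" by blast
    then show ?thesis unfolding neg(2) by simp
  qed
  have "\<nu> (- (- x)) + \<nu> (- (\<alpha> - - x)) = \<nu> (- (- y)) + \<nu> (- (\<alpha> - - y))"
    using xy(7) unfolding neg(2) by simp
  moreover have "- y \<noteq> - x" "- y \<noteq> \<alpha> - - x"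
    using xy(5,6) unfolding neg(1) neg_equal_iff_equal by simp_all
  moreover have "- x \<in> weights" "- y \<in> weights" using xy(1,2) by simp_all
  ultimately show ?thesis
    unfolding weight_trop_def using in' min' by blast
qed

definition zero_pair :: "(real ^ 8 \<Rightarrow> real) \<Rightarrow> real ^ 8 \<Rightarrow> real ^ 8 \<Rightarrow> bool" where
  "zero_pair \<nu> \<alpha> x \<longleftrightarrow> \<nu> x = 0 \<and> \<nu> (\<alpha> - x) = 0"

text \<open>For a nonnegative height a monomial vanishes iff both of its members do, and the rival
  of a vanishing monomial vanishes as well.\<close>

lemma not_once_zero_pair:
  assumes nonneg: "\<And>v. v \<in> weights \<Longrightarrow> 0 \<le> \<nu> v" and trop: "weight_trop \<nu> \<alpha>"
    and pairs: "{v \<in> weights. \<alpha> - v \<in> weights} = (\<Union>x\<in>{x1, x2, x3, x4, x5, x6}. {x, \<alpha> - x})"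
  shows "not_once (zero_pair \<nu> \<alpha> x1) (zero_pair \<nu> \<alpha> x2) (zero_pair \<nu> \<alpha> x3)
    (zero_pair \<nu> \<alpha> x4) (zero_pair \<nu> \<alpha> x5) (zero_pair \<nu> \<alpha> x6)"
proof -
  let ?X = "{x1, x2, x3, x4, x5, x6}"
  have other: "\<exists>y\<in>?X - {x}. zero_pair \<nu> \<alpha> y" if "x \<in> ?X" "zero_pair \<nu> \<alpha> x" for x
  proof -
    have "x \<in> weights" "\<alpha> - x \<in> weights" using that(1) pairs by blast+
    then obtain z where z: "z \<in> weights" "\<alpha> - z \<in> weights" "z \<noteq> x" "z \<noteq> \<alpha> - x"
      "\<nu> z + \<nu> (\<alpha> - z) \<le> \<nu> x + \<nu> (\<alpha> - x)"
      by (rule weight_trop_other[OF trop])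
    then have zero: "\<nu> z = 0" "\<nu> (\<alpha> - z) = 0"
      using nonneg[OF z(1)] nonneg[OF z(2)] that(2) by (auto simp: zero_pair_def)
    have "z \<in> (\<Union>x\<in>?X. {x, \<alpha> - x})" using z pairs by blast
    then obtain y where y: "y \<in> ?X" "z = y \<or> z = \<alpha> - y" by blast
    then have "zero_pair \<nu> \<alpha> y" "y \<noteq> x" using zero z(3,4) by (auto simp: zero_pair_def)
    with y(1) show ?thesis by blast
  qed
  show ?thesis
    unfolding not_once_def
    using other[of x1] other[of x2] other[of x3] other[of x4] other[of x5] other[of x6] by blast
qed

text \<open>A summand has inner product 1 with the root, so it is \<open>wt b i\<close> or
  \<open>- wt k i\<close> with \<open>i\<close> one of the six indices other than \<open>b\<close>
  and \<open>k\<close>; these two are partners.\<close>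

lemma weight_summands_diff:
  assumes UNIV: "UNIV = {a, b, k, l, m, n, p, q}" and dist: "distinct [a, b, k, l, m, n, p, q :: 8]"
  shows "{v \<in> weights. axis b 1 - axis k 1 - v \<in> weights} =
    (\<Union>x\<in>{wt b a, wt b l, wt b m, wt b n, wt b p, wt b q}. {x, axis b 1 - axis k 1 - x})"
proof (intro equalityI subsetI)
  have alt: "axis b 1 - axis k 1 - wt b i = - wt k i" "axis b 1 - axis k 1 - - wt k i = wt b i" for i
    by (simp_all add: wt_def)
  let ?\<alpha> = "axis b 1 - axis k 1 :: real ^ 8"
  fix v assume "v \<in> {v \<in> weights. ?\<alpha> - v \<in> weights}"
  then have v: "v \<in> weights" "?\<alpha> - v \<in> weights" by auto
  have root: "?\<alpha> \<in> E7_roots" using dist by (intro axis_diff_root) auto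
  have one: "v \<bullet> ?\<alpha> = 1" using weight_pair_inner(2)[OF v] root by simp
  have "\<exists>i. i \<notin> {b, k} \<and> (v = wt b i \<or> v = - wt k i)"
    using v(1)
  proof (cases rule: weight_cases)
    case (pos i j)
    with one have "(b = i \<and> j \<notin> {b, k}) \<or> (b = j \<and> i \<notin> {b, k})"
      by (auto simp: inner_commute[of "wt _ _"] axis_diff_inner_wt of_bool_def split: if_splits)
    with pos wt_commute show ?thesis by metis
  next
    case (neg i j)
    with one have "(k = i \<and> j \<notin> {b, k}) \<or> (k = j \<and> i \<notin> {b, k})"
      by (auto simp: inner_commute[of "wt _ _"] axis_diff_inner_wt of_bool_def split: if_splits)
    with neg wt_commute show ?thesis by metis
  qed
  then obtain i where i: "i \<in> {a, l, m, n, p, q}" "v = wt b i \<or> v = - wt k i"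
    using UNIV by blast
  then have "v \<in> {wt b i, ?\<alpha> - wt b i}" using alt by auto
  with i(1) show "v \<in> (\<Union>x\<in>{wt b a, wt b l, wt b m, wt b n, wt b p, wt b q}. {x, ?\<alpha> - x})"
    by blast
next
  have alt: "axis b 1 - axis k 1 - wt b i = - wt k i" for i
    by (simp add: wt_def)
  let ?\<alpha> = "axis b 1 - axis k 1 :: real ^ 8"
  fix v assume "v \<in> (\<Union>x\<in>{wt b a, wt b l, wt b m, wt b n, wt b p, wt b q}. {x, ?\<alpha> - x})"
  then obtain i where i: "i \<in> {a, l, m, n, p, q}" "v = wt b i \<or> v = ?\<alpha> - wt b i" by blast
  then have "b \<noteq> i" "k \<noteq> i" using dist by auto
  then have "wt b i \<in> weights" "?\<alpha> - wt b i \<in> weights" unfolding alt by simp_all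
  with i(2) show "v \<in> {v \<in> weights. ?\<alpha> - v \<in> weights}" by auto
qed

text \<open>The negative partners arise because \<alpha> is also minus the half-sign vector of the
  complementary four indices.\<close>

lemma half_sign_vec_minus_wt:
  assumes UNIV: "UNIV = {a, b, k, l, m, n, p, q}" and dist: "distinct [a, b, k, l, m, n, p, q :: 8]"
  defines "\<alpha> \<equiv> half_sign_vec {a, b, k, l}"
  shows "\<alpha> - wt a b = wt k l" "\<alpha> - wt a k = wt b l" "\<alpha> - wt a l = wt b k"
    and "\<alpha> - - wt m n = - wt p q" "\<alpha> - - wt m p = - wt n q" "\<alpha> - - wt m q = - wt n p"
proof -
  have neg: "\<alpha> = - half_sign_vec {m, n, p, q}"
  proof -
    have "- {a, b, k, l} = {m, n, p, q}" using UNIV dist by auto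
    then show ?thesis using half_sign_vec_uminus[of "{a, b, k, l}"] by (simp add: \<alpha>_def)
  qed
  have perm: "{a, k, b, l} = {a, b, k, l}" "{a, l, b, k} = {a, b, k, l}"
    "{m, p, n, q} = {m, n, p, q}" "{m, q, n, p} = {m, n, p, q}" by auto
  show "\<alpha> - wt a b = wt k l" "\<alpha> - wt a k = wt b l" "\<alpha> - wt a l = wt b k"
    using wt_add[of a b k l] wt_add[of a k b l] wt_add[of a l b k] dist
    by (auto simp: perm \<alpha>_def algebra_simps)
  show "\<alpha> - - wt m n = - wt p q" "\<alpha> - - wt m p = - wt n q" "\<alpha> - - wt m q = - wt n p"
    unfolding neg using wt_add[of m n p q] wt_add[of m p n q] wt_add[of m q n p] dist
    by (auto simp: perm algebra_simps)
qed

text \<open>Three decompositions come from splitting the four indices of the root into two pairs,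
  three more from splitting the complement.\<close>

lemma weight_summands_half:
  assumes UNIV: "UNIV = {a, b, k, l, m, n, p, q}" and dist: "distinct [a, b, k, l, m, n, p, q :: 8]"
  shows "{v \<in> weights. half_sign_vec {a, b, k, l} - v \<in> weights} =
    (\<Union>x\<in>{wt a b, wt a k, wt a l, - wt m n, - wt m p, - wt m q}. {x, half_sign_vec {a, b, k, l} - x})"
    (is "?L = (\<Union>x\<in>?X. {x, ?\<alpha> - x})")
proof -
  have root: "?\<alpha> \<in> E7_roots" using dist by (intro half_sign_vec_root) auto
  have card: "card {a, b, k, l} = 4" using dist by auto
  note alt = half_sign_vec_minus_wt(1-3)[OF UNIV dist] and alt' = half_sign_vec_minus_wt(4-6)[OF UNIV dist]
  show ?thesis
  proof (intro equalityI subsetI)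
    fix v assume "v \<in> ?L"
    then have v: "v \<in> weights" "?\<alpha> - v \<in> weights" by auto
    have one: "v \<bullet> ?\<alpha> = 1" using weight_pair_inner(2)[OF v] root by simp
    have "v \<in> {wt a b, wt a k, wt a l, wt k l, wt b l, wt b k,
        - wt m n, - wt m p, - wt m q, - wt p q, - wt n q, - wt n p}"
      using v(1)
    proof (cases rule: weight_cases)
      case (pos i j)
      with one have "i \<in> {a, b, k, l} \<and> j \<in> {a, b, k, l}"
        by (auto simp: inner_commute[of "wt _ _"] half_inner_wt[OF card] of_bool_def simp del: insert_iff split: if_splits)
      with pos show ?thesis
        using wt_commute[of b a] wt_commute[of k a] wt_commute[of l a] wt_commute[of l k]
          wt_commute[of l b] wt_commute[of k b] by (elim conjE insertE emptyE) simp_all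
    next
      case (neg i j)
      with one have "i \<notin> {a, b, k, l} \<and> j \<notin> {a, b, k, l}"
        by (auto simp: inner_commute[of "wt _ _"] half_inner_wt[OF card] of_bool_def simp del: insert_iff split: if_splits)
      then have "i \<in> {m, n, p, q} \<and> j \<in> {m, n, p, q}" using UNIV by blast
      with neg show ?thesis
        using wt_commute[of n m] wt_commute[of p m] wt_commute[of q m] wt_commute[of q p]
          wt_commute[of q n] wt_commute[of p n] by (elim conjE insertE emptyE) simp_all
    qed
    then show "v \<in> (\<Union>x\<in>?X. {x, ?\<alpha> - x})" by (simp add: alt alt'[simplified]) blast
  next
    fix v assume "v \<in> (\<Union>x\<in>?X. {x, ?\<alpha> - x})"
    then obtain x where x: "x \<in> ?X" "v = x \<or> v = ?\<alpha> - x" by blast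
    have "x \<in> weights \<and> ?\<alpha> - x \<in> weights"
      using x(1) dist by (elim insertE emptyE) (simp_all only: alt alt', auto)
    with x(2) show "v \<in> ?L" by auto
  qed
qed

section \<open>Exchange for antipodal weights\<close>

lemma six_complement_pair:
  assumes "a \<noteq> b" "six (UNIV - {a, b}) k l m n p q"
  shows "UNIV = {a, b, k, l, m, n, p, q :: 8}" "distinct [a, b, k, l, m, n, p, q]"
proof -
  show dist: "distinct [a, b, k, l, m, n, p, q]" using assms by (auto simp: six_def)
  then have "card (set [a, b, k, l, m, n, p, q]) = 8" by (subst distinct_card) simp_all
  then show "UNIV = {a, b, k, l, m, n, p, q}"
    using card_subset_eq[of UNIV "set [a, b, k, l, m, n, p, q]"] by simp
qed

text \<open>Each root is chosen with \<open>wt a b\<close> as a summand. The height vanishes there,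
  so this monomial reduces to its partner, the antipode of a neighbour of \<open>wt a b\<close>. The
  other three rules of the locale are these for the height composed with negation.\<close>

lemma not_once_rules:
  assumes nonneg: "\<And>v. v \<in> weights \<Longrightarrow> 0 \<le> \<nu> v"
    and trop: "\<And>\<alpha>. \<alpha> \<in> E7_roots \<Longrightarrow> weight_trop \<nu> \<alpha>"
    and ab: "a \<noteq> b" "\<nu> (wt a b) = 0" and six: "six (UNIV - {a, b}) k l m n p q"
  shows "not_once (\<nu> (- wt b k) = 0)
      (\<nu> (wt a l) = 0 \<and> \<nu> (- wt k l) = 0) (\<nu> (wt a m) = 0 \<and> \<nu> (- wt k m) = 0)
      (\<nu> (wt a n) = 0 \<and> \<nu> (- wt k n) = 0) (\<nu> (wt a p) = 0 \<and> \<nu> (- wt k p) = 0)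
      (\<nu> (wt a q) = 0 \<and> \<nu> (- wt k q) = 0)" (is ?tb)
    and "not_once (\<nu> (- wt a k) = 0)
      (\<nu> (wt b l) = 0 \<and> \<nu> (- wt k l) = 0) (\<nu> (wt b m) = 0 \<and> \<nu> (- wt k m) = 0)
      (\<nu> (wt b n) = 0 \<and> \<nu> (- wt k n) = 0) (\<nu> (wt b p) = 0 \<and> \<nu> (- wt k p) = 0)
      (\<nu> (wt b q) = 0 \<and> \<nu> (- wt k q) = 0)" (is ?ta)
    and "not_once (\<nu> (wt k l) = 0)
      (\<nu> (wt a k) = 0 \<and> \<nu> (wt b l) = 0) (\<nu> (wt a l) = 0 \<and> \<nu> (wt b k) = 0)
      (\<nu> (- wt m n) = 0 \<and> \<nu> (- wt p q) = 0) (\<nu> (- wt m p) = 0 \<and> \<nu> (- wt n q) = 0)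
      (\<nu> (- wt m q) = 0 \<and> \<nu> (- wt n p) = 0)" (is ?tc)
proof -
  note U = six_complement_pair[OF ab(1) six]
  have alt: "axis i 1 - axis k 1 - wt i j = - wt k j" for i j k :: 8 by (simp add: wt_def)
  have ba: "\<nu> (wt b a) = 0" using ab(2) by (simp add: wt_commute)
  have U': "UNIV = {b, a, k, l, m, n, p, q}" "distinct [b, a, k, l, m, n, p, q]"
    using U by auto
  have "axis b 1 - axis k 1 \<in> E7_roots" "axis a 1 - axis k 1 \<in> E7_roots"
    using U(2) by (auto intro!: axis_diff_root)
  note D = not_once_zero_pair[OF nonneg trop[OF this(1)] weight_summands_diff[OF U]]
    not_once_zero_pair[OF nonneg trop[OF this(2)] weight_summands_diff[OF U']]
  from D(2) show ?tb
    unfolding zero_pair_def alt using ab(2) by (simp add: wt_commute[of k b])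
  from D(1) show ?ta
    unfolding zero_pair_def alt using ba by (simp add: wt_commute[of k a])
  have "half_sign_vec {a, b, k, l} \<in> E7_roots"
    using U(2) by (intro half_sign_vec_root) auto
  from not_once_zero_pair[OF nonneg trop[OF this] weight_summands_half[OF U]]
  show ?tc
    unfolding zero_pair_def half_sign_vec_minus_wt[OF U] using ab(2) by simp
qed

text \<open>Otherwise let \<open>x\<close> have the least height among the other weights and let
  \<open>s\<close> be the one of \<open>v\<close>, \<open>- v\<close> at distance 2 from
  \<open>x\<close>. The monomial of \<open>x\<close> and \<open>s\<close> has value
  \<open>\<nu> x\<close>, whereas a rival consists of two other weights and is at least twice as
  high.\<close>

lemma weight_trop_positive:
  assumes nonneg: "\<And>v. v \<in> weights \<Longrightarrow> 0 \<le> \<nu> v"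
    and trop: "\<And>\<alpha>. \<alpha> \<in> E7_roots \<Longrightarrow> weight_trop \<nu> \<alpha>"
    and v: "v \<in> weights" "\<nu> v = 0" "\<nu> (- v) = 0"
  shows "\<exists>x\<in>weights. x \<noteq> v \<and> x \<noteq> - v \<and> \<nu> x = 0"
proof (rule ccontr)
  assume contra: "\<not> ?thesis"
  let ?N = "weights - {v, - v}"
  have pos: "0 < \<nu> x" if "x \<in> ?N" for x
  proof -
    have "\<nu> x \<noteq> 0" using that contra by blast
    with nonneg[of x] that show ?thesis by simp
  qed
  obtain y where "y \<in> weights" "v \<bullet> y = 1 / 2" using ex_adjacent[OF v(1)] .
  then have "y \<in> ?N" using v(1) by (auto simp: weight_inner_self)
  then obtain x where x: "x \<in> ?N" and min: "\<And>y. y \<in> ?N \<Longrightarrow> \<nu> x \<le> \<nu> y"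
    using finite_weights arg_min_if_finite[of ?N \<nu>] by (metis emptyE finite_Diff not_le)
  have "v \<bullet> x = - 1 / 2 \<or> - v \<bullet> x = - 1 / 2"
    using weight_inner_weight[of v x] weight_eqI[of v x] weight_eqI[of "- v" x] v(1) x by auto
  then obtain s where s: "s = v \<or> s = - v" "s \<bullet> x = - 1 / 2" by blast
  then have sw: "s \<in> weights" "\<nu> s = 0" "?N = weights - {s, - s}" using v by auto
  have root: "x + s \<in> E7_roots"
    using weight_diff_root[of x "- s"] x s(2) sw(1) by (simp add: inner_commute)
  then obtain z where z: "z \<in> weights" "x + s - z \<in> weights" "z \<noteq> x" "z \<noteq> s"
    "\<nu> z + \<nu> (x + s - z) \<le> \<nu> x"
    using weight_trop_other[OF trop[OF root], of x] x sw by auto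
  \<comment> \<open>Summands of a root have inner product 1 with it, so a rival cannot involve
    \<open>- s\<close>.\<close>
  have one: "- s \<bullet> (x + s) = - 1"
    using s(2) sw(1) by (simp add: inner_add_right weight_inner_self)
  have "y \<noteq> - s" if "y \<bullet> (x + s) = 1" for y using one that by auto
  then have "z \<noteq> - s" "x + s - z \<noteq> - s"
    using weight_pair_inner(2,3)[OF z(1,2)] root by simp_all
  moreover have "x + s - z \<noteq> s" using z(3) by auto
  ultimately have "z \<in> ?N" "x + s - z \<in> ?N" unfolding sw(3) using z by auto
  with min[of z] min[of "x + s - z"] pos[OF x] z(5) show False by simp
qed

text \<open>The negated claim supplies the disjointness hypotheses of
  \<open>tropical_double_six\<close>. The locale then removes all zeros but the two given ones,
  against \<open>weight_trop_positive\<close>.\<close>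

lemma antipodal_exchange_wt:
  assumes nonneg: "\<And>v. v \<in> weights \<Longrightarrow> 0 \<le> \<nu> v"
    and trop: "\<And>\<alpha>. \<alpha> \<in> E7_roots \<Longrightarrow> weight_trop \<nu> \<alpha>"
    and ab: "a \<noteq> b" "\<nu> (wt a b) = 0" "\<nu> (- wt a b) = 0"
  shows "\<exists>x\<in>weights. x \<noteq> wt a b \<and> x \<noteq> - wt a b \<and> \<nu> x = 0 \<and> \<nu> (- x) = 0"
proof (rule ccontr)
  assume contra: "\<not> ?thesis"
  let ?I = "UNIV - {a, b}"
  let ?\<nu>' = "\<lambda>v. \<nu> (- v)"
  have nonneg': "0 \<le> ?\<nu>' v" if "v \<in> weights" for v using nonneg that by simp
  have trop': "weight_trop ?\<nu>' \<alpha>" if "\<alpha> \<in> E7_roots" for \<alpha>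
    using weight_trop_uminus trop uminus_root that by blast
  note rules = not_once_rules[of \<nu>, OF nonneg trop ab(1,2)]
    not_once_rules[of ?\<nu>', OF nonneg' trop' ab(1,3), unfolded minus_minus]
  have ne: "wt i j \<noteq> wt a b \<and> wt i j \<noteq> - wt a b" if "i \<noteq> j" "j \<in> ?I" for i j
  proof -
    have "wt i j \<bullet> wt a b \<notin> {3 / 2, - 3 / 2}"
      using that ab(1) by (auto simp: wt_inner_wt of_bool_def)
    then show ?thesis using ab(1) weight_inner_self[of "wt a b"] by auto
  qed
  have disj: "\<not> (\<nu> (wt i j) = 0 \<and> \<nu> (- wt i j) = 0)" if "i \<noteq> j" "j \<in> ?I" for i j
    using contra ne[OF that] wt_in_weights[OF that(1)] by blast
  interpret tropical_double_six ?I
    "\<lambda>k. \<nu> (wt a k) = 0" "\<lambda>k. \<nu> (wt b k) = 0" "\<lambda>k. \<nu> (- wt a k) = 0" "\<lambda>k. \<nu> (- wt b k) = 0"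
    "\<lambda>k l. \<nu> (- wt k l) = 0" "\<lambda>k l. \<nu> (wt k l) = 0"
  proof unfold_locales
    show "card ?I = 6" using ab(1) by (simp add: card_Diff_subset)
    show "\<not> (\<nu> (wt a k) = 0 \<and> \<nu> (- wt a k) = 0)" "\<not> (\<nu> (wt b k) = 0 \<and> \<nu> (- wt b k) = 0)"
      if "k \<in> ?I" for k
      using disj[of a k] disj[of b k] that by auto
    show "\<not> (\<nu> (- wt k l) = 0 \<and> \<nu> (wt k l) = 0)" if "k \<in> ?I" "l \<in> ?I" "k \<noteq> l" for k l
      using disj[of k l] that by auto
    show "(\<nu> (- wt k l) = 0) = (\<nu> (- wt l k) = 0)" "(\<nu> (wt k l) = 0) = (\<nu> (wt l k) = 0)" for k l
      by (simp_all only: wt_commute[of k l])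
  qed (rule rules; assumption)+
  obtain x where x: "x \<in> weights" "x \<noteq> wt a b" "x \<noteq> - wt a b" "\<nu> x = 0"
    using weight_trop_positive[OF nonneg trop wt_in_weights[OF ab(1)] ab(2,3)] by blast
  have nonzero: "\<nu> (wt i j) \<noteq> 0 \<and> \<nu> (- wt i j) \<noteq> 0" if ij: "i \<noteq> j" "wt i j \<noteq> wt a b" for i j
  proof -
    have "wt i j \<noteq> wt b a" using ij(2) by (simp add: wt_commute[of b a])
    with ij consider "i = a" "j \<in> ?I" | "i = b" "j \<in> ?I" | "i \<in> ?I" "j = a" | "i \<in> ?I" "j = b"
      | "i \<in> ?I" "j \<in> ?I" by auto
    then show ?thesis
      using not_any[of i] not_any[of j] no_zero(5,6)[of i j] ij(1)
        wt_commute[of i a] wt_commute[of i b]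
      by cases simp_all
  qed
  from x(1) show False
    by (cases rule: weight_cases) (use x nonzero in auto)
qed

section \<open>Cells and strong exchange\<close>

text \<open>A weight other than \<open>v\<close> and \<open>- v\<close> is a neighbour of
  \<open>v\<close> or has its antipode as one, and the zero conditions are symmetric under
  negation.\<close>

lemma antipodal_exchange:
  assumes nonneg: "\<And>v. v \<in> weights \<Longrightarrow> 0 \<le> \<nu> v"
    and trop: "\<And>\<alpha>. \<alpha> \<in> E7_roots \<Longrightarrow> weight_trop \<nu> \<alpha>"
    and v: "v \<in> weights" "\<nu> v = 0" "\<nu> (- v) = 0"
  shows "\<exists>x\<in>weights. v \<bullet> x = 1 / 2 \<and> \<nu> x = 0 \<and> \<nu> (- x) = 0"
proof -
  have "\<exists>x\<in>weights. x \<noteq> v \<and> x \<noteq> - v \<and> \<nu> x = 0 \<and> \<nu> (- x) = 0"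
    using v(1)
  proof (cases rule: weight_cases)
    case (pos a b)
    then show ?thesis using antipodal_exchange_wt[OF nonneg trop pos(1)] v by simp
  next
    case (neg a b)
    then show ?thesis using antipodal_exchange_wt[OF nonneg trop neg(1)] v by auto
  qed
  then obtain x where x: "x \<in> weights" "x \<noteq> v" "x \<noteq> - v" "\<nu> x = 0" "\<nu> (- x) = 0" by blast
  have "v \<bullet> x = 1 / 2 \<or> v \<bullet> - x = 1 / 2"
    using weight_inner_weight[OF v(1) x(1)] weight_eqI[OF v(1) x(1)] weight_eqI[of "- v" x] v(1) x by auto
  then show ?thesis using x by (metis uminus_in_weights minus_minus)
qed

lemma minimizers_convex_hull:
  fixes S :: "'a::euclidean_space set"
  assumes "finite S"
  shows "{z \<in> convex hull S. \<forall>y\<in>convex hull S. a \<bullet> z \<le> a \<bullet> y} =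
    convex hull {z \<in> S. \<forall>y\<in>S. a \<bullet> z \<le> a \<bullet> y}"
proof (cases "S = {}")
  case False
  then obtain m where m: "m \<in> S" "\<And>y. y \<in> S \<Longrightarrow> a \<bullet> m \<le> a \<bullet> y"
    using assms arg_min_if_finite[of S "\<lambda>x. a \<bullet> x"] by (metis not_le)
  have "convex hull S \<subseteq> {y. a \<bullet> y \<ge> a \<bullet> m}"
    using m by (intro hull_minimal convex_halfspace_ge) auto
  then have "{z \<in> convex hull S. \<forall>y\<in>convex hull S. a \<bullet> z \<le> a \<bullet> y} =
      convex hull S \<inter> {z. - a \<bullet> z = - (a \<bullet> m)}"
    using hull_inc[OF m(1), of convex] by force
  also have "\<dots> = convex hull {z \<in> S. - a \<bullet> z = - (a \<bullet> m)}"
    using m(2) by (intro face_of_convex_hull_max(1)[OF assms]) simp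
  also have "{z \<in> S. - a \<bullet> z = - (a \<bullet> m)} = {z \<in> S. \<forall>y\<in>S. a \<bullet> z \<le> a \<bullet> y}"
    using m by force
  finally show ?thesis .
qed simp

lemma induced_subdivision_finite:
  fixes V :: "'a::euclidean_space set"
  assumes "finite V"
  shows "induced_subdivision V \<mu> =
    range (\<lambda>u. convex hull {v \<in> V. \<forall>w\<in>V. u \<bullet> v + \<mu> v \<le> u \<bullet> w + \<mu> w})"
proof -
  let ?L = "(\<lambda>v. (v, \<mu> v)) ` V"
  have "fst ` {z \<in> convex hull ?L. \<forall>y\<in>convex hull ?L. (u, 1) \<bullet> z \<le> (u, 1) \<bullet> y} =
      convex hull {v \<in> V. \<forall>w\<in>V. u \<bullet> v + \<mu> v \<le> u \<bullet> w + \<mu> w}" for u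
  proof -
    have "fst ` {z \<in> ?L. \<forall>y\<in>?L. (u, 1) \<bullet> z \<le> (u, 1) \<bullet> y} =
        {v \<in> V. \<forall>w\<in>V. u \<bullet> v + \<mu> v \<le> u \<bullet> w + \<mu> w}"
      by force
    then show ?thesis
      using assms by (simp add: minimizers_convex_hull convex_hull_linear_image[OF linear_fst])
  qed
  moreover have "lower_faces P = range (\<lambda>u. {z \<in> P. \<forall>y\<in>P. (u, 1) \<bullet> z \<le> (u, 1) \<bullet> y})"
    for P :: "('a \<times> real) set"
    unfolding lower_faces_def by auto
  ultimately show ?thesis
    unfolding induced_subdivision_def lifted_polytope_def by (simp only: image_image)
qed

text \<open>In product form the condition is visibly unchanged when both points are scaled by
  \<open>c\<close>, whatever its sign.\<close>

lemma mirror_separates_iff: "mirror_separates \<alpha> A B \<longleftrightarrow> (A \<bullet> \<alpha>) * (B \<bullet> \<alpha>) < 0"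
  by (auto simp: mirror_separates_def mult_less_0_iff)

definition cell :: "(real ^ 8 \<Rightarrow> real) \<Rightarrow> real ^ 8 \<Rightarrow> (real ^ 8) set" where
  "cell \<nu> u = {v \<in> weights. \<forall>w\<in>weights. u \<bullet> v + \<nu> v \<le> u \<bullet> w + \<nu> w}"

definition strong_exchange :: "(real ^ 8) set \<Rightarrow> bool" where
  "strong_exchange K \<longleftrightarrow> (\<forall>v\<in>K. \<forall>w\<in>K. v \<noteq> w \<longrightarrow>
     (\<exists>\<alpha>\<in>E7_roots. (v \<bullet> \<alpha>) * (w \<bullet> \<alpha>) < 0 \<and> root_refl \<alpha> v \<in> K \<and> root_refl \<alpha> w \<in> K))"

lemma root_as_sum:
  assumes "\<alpha> \<in> E7_roots"
  obtains v w where "v \<in> weights" "w \<in> weights" "\<alpha> = v + w"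
proof -
  have "\<exists>v\<in>weights. v \<bullet> \<alpha> = 1"
    using assms
  proof (cases rule: root_cases)
    case (diff a b)
    have "card {a, b} < 8" using diff by simp
    then obtain k where "k \<notin> {a, b}" by (rule ex_notin)
    with diff show ?thesis
      by (intro bexI[of _ "wt a k"]) (auto simp: inner_commute[of "wt _ _"] axis_diff_inner_wt)
  next
    case (half S)
    then obtain i where i: "i \<in> S" by fastforce
    with half have "card (S - {i}) = 3" by simp
    then have "S - {i} \<noteq> {}" by (metis card.empty zero_neq_numeral)
    then obtain j where "j \<in> S" "j \<noteq> i" by blast
    with half i show ?thesis
      by (intro bexI[of _ "wt i j"]) (auto simp: inner_commute[of "wt _ _"] half_inner_wt)
  qed
  then obtain v where v: "v \<in> weights" "v \<bullet> \<alpha> = 1" by blast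
  then have "- (v - \<alpha>) \<in> weights" using weight_diff_weight[OF v(1) assms] by (simp only: uminus_in_weights)
  then show thesis using that[of v "\<alpha> - v"] v by simp
qed

text \<open>It suffices to find a neighbour \<open>x\<close> of \<open>v\<close> such that
  reflection in \<open>v - x\<close> sends \<open>w\<close> to \<open>v + w - x\<close>, with both
  images in the cell.\<close>

lemma strong_exchange_cell:
  assumes trop: "\<And>\<alpha>. \<alpha> \<in> E7_roots \<Longrightarrow> weight_trop \<nu> \<alpha>"
  shows "strong_exchange (cell \<nu> u)"
  unfolding strong_exchange_def
proof (intro ballI impI)
  fix v w assume vw: "v \<in> cell \<nu> u" "w \<in> cell \<nu> u" "v \<noteq> w"
  \<comment> \<open>Adding the functional and subtracting the minimum gives a nonnegative height
    whose zeros are the cell; the tropical conditions persist.\<close>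
  define \<nu>' where "\<nu>' = (\<lambda>x. \<nu> x + u \<bullet> x + - (\<nu> v + u \<bullet> v))"
  have in_cell: "x \<in> cell \<nu> u \<longleftrightarrow> \<nu>' x = 0" if "x \<in> weights" for x
    using vw(1) that by (force simp: cell_def \<nu>'_def)
  have nonneg: "0 \<le> \<nu>' x" if "x \<in> weights" for x
    using vw(1) that by (auto simp: cell_def \<nu>'_def)
  have trop': "weight_trop \<nu>' \<alpha>" if "\<alpha> \<in> E7_roots" for \<alpha>
    unfolding \<nu>'_def using trop that by (intro weight_trop_add_linear) auto
  have wts: "v \<in> weights" "w \<in> weights" using vw by (auto simp: cell_def)
  have zero: "\<nu>' v = 0" "\<nu>' w = 0" using in_cell vw wts by auto
  have "\<exists>x\<in>weights. \<nu>' x = 0 \<and> v \<bullet> x = 1 / 2 \<and> v + w - x \<in> weights \<and> \<nu>' (v + w - x) = 0 \<and>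
      w \<bullet> (v - x) = - 1"
    if ne: "v \<bullet> w \<noteq> 1 / 2"
  proof -
    consider "v \<bullet> w = - 1 / 2" | "v \<bullet> w = - 3 / 2"
      using ne weight_inner_weight[OF wts] weight_eqI[OF wts] vw(3) by auto
    then show ?thesis
    proof cases
      case 1
      then have root: "v + w \<in> E7_roots" using weight_diff_root[of v "- w"] wts by simp
      have "v + w - v \<in> weights" using wts by simp
      from weight_trop_other[OF trop'[OF root] wts(1) this]
      obtain x where x: "x \<in> weights" "v + w - x \<in> weights" "x \<noteq> v" "x \<noteq> w"
        "\<nu>' x + \<nu>' (v + w - x) \<le> 0"
        using zero by auto
      then have "\<nu>' x = 0" "\<nu>' (v + w - x) = 0" using nonneg[OF x(1)] nonneg[OF x(2)] by auto
      moreover have "x \<bullet> (v + w) = 1"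
        using weight_pair_inner(2)[OF x(1,2)] root by simp
      then have "v \<bullet> x + w \<bullet> x = 1" by (simp add: inner_add_right inner_commute)
      then have "v \<bullet> x = 1 / 2" "w \<bullet> x = 1 / 2"
        using weight_inner_weight[OF wts(1) x(1)] weight_inner_weight[OF wts(2) x(1)]
          weight_eqI[OF wts(1) x(1)] weight_eqI[OF wts(2) x(1)] x(3,4) by auto
      ultimately show ?thesis
        using x 1 by (intro bexI[of _ x]) (auto simp: inner_diff_right inner_commute[of w v])
    next
      case 2
      then have w: "w = - v" using weight_eqI[of v "- w"] wts by simp
      then obtain x where "x \<in> weights" "v \<bullet> x = 1 / 2" "\<nu>' x = 0" "\<nu>' (- x) = 0"
        using antipodal_exchange[OF nonneg trop' wts(1)] zero by auto
      then show ?thesis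
        using wts(1) w by (intro bexI[of _ x]) (auto simp: inner_diff_right weight_inner_self)
    qed
  qed
  \<comment> \<open>For neighbours the choice \<open>x = w\<close> works: the reflection just
    exchanges them.\<close>
  moreover have "w \<bullet> (v - w) = - 1" "v + w - w = v" if "v \<bullet> w = 1 / 2"
    using that wts by (simp_all add: inner_diff_right weight_inner_self inner_commute[of w v])
  ultimately obtain x where x: "x \<in> weights" "\<nu>' x = 0" "v \<bullet> x = 1 / 2" "v + w - x \<in> weights"
    "\<nu>' (v + w - x) = 0" "w \<bullet> (v - x) = - 1"
    using wts zero by metis
  have root: "v - x \<in> E7_roots" using weight_diff_root[OF wts(1) x(1,3)] .
  have "v \<bullet> (v - x) = 1" using x wts by (simp add: inner_diff_right weight_inner_self)
  moreover have "root_refl (v - x) v = x" "root_refl (v - x) w = v + w - x"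
    using \<open>v \<bullet> (v - x) = 1\<close> x(6) by (simp_all add: root_refl_root[OF root])
  ultimately show "\<exists>\<alpha>\<in>E7_roots. (v \<bullet> \<alpha>) * (w \<bullet> \<alpha>) < 0 \<and> root_refl \<alpha> v \<in> cell \<nu> u \<and> root_refl \<alpha> w \<in> cell \<nu> u"
    using root x in_cell by (intro bexI[of _ "v - x"]) auto
qed

text \<open>A separating reflection moves \<open>x\<close> by a root, of squared length 2, so the
  image is not \<open>x\<close>; nor is it \<open>y\<close>, at squared distance 4.\<close>

lemma not_strong_exchange_pair:
  assumes "x \<in> weights" "y \<in> weights" "x + y \<in> E7_roots"
  shows "\<not> strong_exchange {x, y}"
proof
  note inner = weight_pair_inner[OF assms]
  assume "strong_exchange {x, y}"
  moreover have "x \<noteq> y" using inner(1) assms(1) by (auto simp: weight_inner_self)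
  ultimately obtain \<beta> where \<beta>: "\<beta> \<in> E7_roots" "(x \<bullet> \<beta>) * (y \<bullet> \<beta>) < 0" "root_refl \<beta> x \<in> {x, y}"
    unfolding strong_exchange_def by blast
  then have "x \<bullet> \<beta> = 1 \<or> x \<bullet> \<beta> = - 1" using weight_inner_root[OF assms(1) \<beta>(1)] by auto
  moreover have "\<beta> \<bullet> \<beta> = 2" by (rule root_inner_self[OF \<beta>(1)])
  ultimately have "(x - root_refl \<beta> x) \<bullet> (x - root_refl \<beta> x) = 2"
    by (auto simp: root_refl_root[OF \<beta>(1)])
  moreover have "(x - y) \<bullet> (x - y) = 4"
    using assms inner by (simp add: inner_diff_left inner_diff_right weight_inner_self inner_commute[of y x])
  ultimately show False using \<beta>(3) by auto
qed

text \<open>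
  If the pair \<open>x\<close>, \<open>\<alpha> - x\<close> is the only minimum, take the functional \<open>U - t \<alpha>\<close>: large \<open>t\<close> forces the
  cell into the cross-polytope of \<open>\<alpha>\<close>, and \<open>U\<close> equalizes the heights on each antipodal pair of it, using
  that its diagonals \<open>y - \<alpha> / 2\<close> are orthonormal.
\<close>

lemma weight_trop_of_strong_exchange:
  assumes strong: "\<And>u. strong_exchange (cell \<nu> u)" and \<alpha>: "\<alpha> \<in> E7_roots"
  shows "weight_trop \<nu> \<alpha>"
proof (rule ccontr)
  assume contra: "\<not> weight_trop \<nu> \<alpha>"
  define P where "P = {x \<in> weights. \<alpha> - x \<in> weights}"
  define g where "g x = \<nu> x + \<nu> (\<alpha> - x)" for x
  have fin: "finite P" using finite_weights by (simp add: P_def)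
  obtain v w where vw: "v \<in> weights" "w \<in> weights" "\<alpha> = v + w" using root_as_sum[OF \<alpha>] .
  then have "v \<in> P" by (simp add: P_def)
  then obtain x where x: "x \<in> P" and min: "\<And>y. y \<in> P \<Longrightarrow> g x \<le> g y"
    using fin arg_min_if_finite[of P g] by (metis emptyE not_le)
  have strict: "g x < g y" if "y \<in> P" "y \<noteq> x" "y \<noteq> \<alpha> - x" for y
  proof -
    have "g x \<noteq> g y"
      using contra x min that unfolding weight_trop_def P_def g_def by blast
    with min[OF that(1)] show ?thesis by simp
  qed
  have P_compl: "\<alpha> - y \<in> P" if "y \<in> P" for y using that by (simp add: P_def)
  have inP: "y \<bullet> \<alpha> = 1" if "y \<in> P" for y
    using weight_pair_inner(2)[of y "\<alpha> - y"] that \<alpha> by (simp add: P_def)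
  have notP: "y \<bullet> \<alpha> \<le> 0" if "y \<in> weights" "y \<notin> P" for y
  proof -
    have "y \<bullet> \<alpha> \<noteq> 1"
    proof
      assume "y \<bullet> \<alpha> = 1"
      then have "- (y - \<alpha>) \<in> weights"
        using weight_diff_weight[OF that(1) \<alpha>] by (simp only: uminus_in_weights)
      with that show False by (simp add: P_def)
    qed
    with weight_inner_root[OF that(1) \<alpha>] show ?thesis by auto
  qed
  have orth: "(y - (1 / 2) *\<^sub>R \<alpha>) \<bullet> z = of_bool (y = z) - of_bool (y = \<alpha> - z)" if "y \<in> P" "z \<in> P" for y z
  proof -
    have yz: "y \<in> weights" "z \<in> weights" "\<alpha> - z \<in> weights" using that by (auto simp: P_def)
    have zz: "z \<bullet> (\<alpha> - z) = - 1 / 2" using weight_pair_inner(1)[of z "\<alpha> - z"] yz \<alpha> by simp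
    have sum: "y \<bullet> z + y \<bullet> (\<alpha> - z) = 1" using inP[OF that(1)] by (simp add: inner_diff_right)
    have lhs: "(y - (1 / 2) *\<^sub>R \<alpha>) \<bullet> z = y \<bullet> z - 1 / 2"
      using inP[OF that(2)] by (simp add: inner_diff_left inner_commute[of \<alpha>])
    show ?thesis
    proof (cases "y = z \<or> y = \<alpha> - z")
      case True
      moreover have "z \<noteq> \<alpha> - z" using zz yz by (auto simp: weight_inner_self)
      ultimately show ?thesis
        unfolding lhs using zz yz by (auto simp: weight_inner_self inner_commute)
    next
      case False
      then have "y \<bullet> z = 1 / 2"
        using weight_inner_weight[OF yz(1,2)] weight_inner_weight[OF yz(1,3)]
          weight_eqI[OF yz(1,2)] weight_eqI[OF yz(1,3)] sum by auto
      with False show ?thesis unfolding lhs by simp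
    qed
  qed
  define k where "k y = (\<nu> (\<alpha> - y) - \<nu> y) / 2" for y
  \<comment> \<open>Each diagonal occurs twice, for \<open>y\<close> and for
    \<open>\<alpha> - y\<close>, with both the vector and \<open>k\<close> changing sign. The two
    terms are equal, hence the factor 1/2.\<close>
  define U where "U = (\<Sum>y\<in>P. (k y / 2) *\<^sub>R (y - (1 / 2) *\<^sub>R \<alpha>))"
  have U: "U \<bullet> z = k z" if "z \<in> P" for z
  proof -
    have "U \<bullet> z = (\<Sum>y\<in>P. k y / 2 * (of_bool (y = z) - of_bool (y = \<alpha> - z)))"
      unfolding U_def inner_sum_left by (intro sum.cong) (simp_all add: orth[OF _ that])
    also have "\<dots> = (\<Sum>y\<in>P. if y = z then k y / 2 else 0) - (\<Sum>y\<in>P. if y = \<alpha> - z then k y / 2 else 0)"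
      unfolding sum_subtractf[symmetric] by (intro sum.cong) auto
    also have "\<dots> = k z / 2 - k (\<alpha> - z) / 2"
      using that P_compl[OF that] fin by (simp add: sum.delta)
    also have "\<dots> = k z" by (simp add: k_def field_simps)
    finally show ?thesis .
  qed
  \<comment> \<open>Outside \<open>P\<close> the root is at most 0, so subtracting \<open>t\<close>
    times it does not lower the value there; the sum bounds the values of \<open>U\<close> plus the
    height from below, and the first two terms give the strict gap to
    \<open>g x / 2\<close>.\<close>
  define t where "t = \<bar>g x\<bar> + 1 + (\<Sum>z\<in>weights. \<bar>U \<bullet> z + \<nu> z\<bar>)"
  define u where "u = U - t *\<^sub>R \<alpha>"
  have onP: "u \<bullet> z + \<nu> z = g z / 2 - t" if "z \<in> P" for z
    using inP[OF that] U[OF that] by (simp add: u_def inner_diff_left inner_commute[of \<alpha>] k_def g_def field_simps)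
  have offP: "g x / 2 - t < u \<bullet> z + \<nu> z" if "z \<in> weights" "z \<notin> P" for z
  proof -
    have "\<bar>U \<bullet> z + \<nu> z\<bar> \<le> (\<Sum>z\<in>weights. \<bar>U \<bullet> z + \<nu> z\<bar>)"
      using finite_weights that(1) by (intro member_le_sum) auto
    moreover have "0 \<le> (\<Sum>z\<in>weights. \<bar>U \<bullet> z + \<nu> z\<bar>)" by (simp add: sum_nonneg)
    then have "0 \<le> t" by (simp add: t_def)
    then have "t * (z \<bullet> \<alpha>) \<le> 0" using notP[OF that] by (simp add: mult_nonneg_nonpos)
    ultimately show ?thesis
      by (simp add: u_def t_def inner_diff_left inner_commute[of \<alpha>])
  qed
  have gx: "g (\<alpha> - x) = g x" by (simp add: g_def)
  have least: "g x / 2 - t \<le> u \<bullet> z + \<nu> z" if "z \<in> weights" for z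
    using offP[OF that] onP[of z] min[of z] by (cases "z \<in> P") auto
  have "cell \<nu> u = {x, \<alpha> - x}"
  proof (intro equalityI subsetI)
    fix z assume z: "z \<in> cell \<nu> u"
    then have le: "u \<bullet> z + \<nu> z \<le> g x / 2 - t" and zw: "z \<in> weights"
      using x onP[OF x] by (auto simp: cell_def P_def)
    then have "z \<in> P" using offP by force
    with le onP[of z] have "g z \<le> g x" by simp
    with strict[OF \<open>z \<in> P\<close>] show "z \<in> {x, \<alpha> - x}" by force
  next
    fix z assume z: "z \<in> {x, \<alpha> - x}"
    then have "z \<in> P" using x P_compl by auto
    moreover have "g z = g x" using z gx by auto
    ultimately have "z \<in> weights" "u \<bullet> z + \<nu> z = g x / 2 - t" using onP[of z] by (auto simp: P_def)
    then show "z \<in> cell \<nu> u" using least by (simp add: cell_def)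
  qed
  moreover have "\<not> strong_exchange {x, \<alpha> - x}"
    using x \<alpha> by (intro not_strong_exchange_pair) (auto simp: P_def)
  ultimately show False using strong[of u] by simp
qed

section \<open>Translation of both conditions to the weights\<close>

context
  fixes p :: "real ^ 8" and c :: real
  assumes c: "c \<noteq> 0" and p: "p = c *\<^sub>R wt 7 8"
begin

lemma strong_coxeter_matroid_p:
  assumes "K \<subseteq> weights"
  shows "strong_coxeter_matroid p ((*\<^sub>R) c ` K) \<longleftrightarrow> strong_exchange K"
proof -
  have "(*\<^sub>R) c ` K \<subseteq> verts_321 p" using assms verts_p[OF c p] by auto
  moreover have "mirror_separates \<alpha> (c *\<^sub>R v) (c *\<^sub>R w) \<longleftrightarrow> (v \<bullet> \<alpha>) * (w \<bullet> \<alpha>) < 0"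
    for \<alpha> v w :: "real ^ 8"
  proof -
    have "((c *\<^sub>R v) \<bullet> \<alpha>) * ((c *\<^sub>R w) \<bullet> \<alpha>) = c\<^sup>2 * ((v \<bullet> \<alpha>) * (w \<bullet> \<alpha>))"
      by (simp add: power2_eq_square)
    moreover have "c\<^sup>2 * t < 0 \<longleftrightarrow> t < 0" for t
      using c by (simp add: mult_less_0_iff)
    ultimately show ?thesis unfolding mirror_separates_iff by (simp only:)
  qed
  moreover have "c *\<^sub>R v \<in> (*\<^sub>R) c ` K \<longleftrightarrow> v \<in> K" for v using c by auto
  ultimately show ?thesis
    using c by (simp add: strong_coxeter_matroid_def strong_exchange_def root_refl_scaleR)
qed

text \<open>Convex position makes the vertex set \<open>M\<close> of a cell unique, so the
  existential condition is one on the set of minimizers itself. Rescaling the functional by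
  \<open>c\<close> only permutes the functionals.\<close>

lemma induces_strong_matroidal_p:
  "induces_strong_matroidal p \<mu> \<longleftrightarrow> (\<forall>u. strong_exchange (cell (\<lambda>v. \<mu> (c *\<^sub>R v)) u))"
proof -
  let ?\<nu> = "\<lambda>v. \<mu> (c *\<^sub>R v)"
  have fin: "finite (verts_321 p)" using finite_weights by (simp add: verts_p[OF c p])
  have cells: "{v \<in> verts_321 p. \<forall>w\<in>verts_321 p. u \<bullet> v + \<mu> v \<le> u \<bullet> w + \<mu> w} =
      (*\<^sub>R) c ` cell ?\<nu> (c *\<^sub>R u)" for u
    by (auto simp: verts_p[OF c p] cell_def)
  have surj: "range (\<lambda>u. convex hull ((*\<^sub>R) c ` cell ?\<nu> (c *\<^sub>R u))) =
      range (\<lambda>u. convex hull ((*\<^sub>R) c ` cell ?\<nu> u))"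
  proof (intro equalityI subsetI)
    fix Q assume "Q \<in> range (\<lambda>u. convex hull ((*\<^sub>R) c ` cell ?\<nu> u))"
    then obtain u where "Q = convex hull ((*\<^sub>R) c ` cell ?\<nu> u)" by blast
    then have "Q = convex hull ((*\<^sub>R) c ` cell ?\<nu> (c *\<^sub>R (inverse c *\<^sub>R u)))" using c by simp
    then show "Q \<in> range (\<lambda>u. convex hull ((*\<^sub>R) c ` cell ?\<nu> (c *\<^sub>R u)))" by blast
  qed blast
  have matroid: "(\<exists>M. strong_coxeter_matroid p M \<and> convex hull ((*\<^sub>R) c ` K) = Delta M) \<longleftrightarrow>
      strong_exchange K" if K: "K \<subseteq> weights" for K
  proof
    assume "\<exists>M. strong_coxeter_matroid p M \<and> convex hull ((*\<^sub>R) c ` K) = Delta M"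
    then obtain M where M: "strong_coxeter_matroid p M" "convex hull ((*\<^sub>R) c ` K) = convex hull M"
      by (auto simp: Delta_def)
    then have "M \<subseteq> (*\<^sub>R) c ` weights" by (simp add: strong_coxeter_matroid_def verts_p[OF c p])
    then obtain K' where K': "K' \<subseteq> weights" "M = (*\<^sub>R) c ` K'" by (meson subset_imageE)
    have "v \<in> K \<longleftrightarrow> v \<in> K'" if "v \<in> weights" for v
      using weight_in_hull_iff[OF c K that] weight_in_hull_iff[OF c K'(1) that] M(2) K'(2) by simp
    then have "K = K'" using K K'(1) by blast
    then show "strong_exchange K" using M(1) K' strong_coxeter_matroid_p by simp
  next
    assume "strong_exchange K"
    then show "\<exists>M. strong_coxeter_matroid p M \<and> convex hull ((*\<^sub>R) c ` K) = Delta M"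
      using strong_coxeter_matroid_p[OF K] by (auto simp: Delta_def)
  qed
  have sub: "cell ?\<nu> u \<subseteq> weights" for u by (auto simp: cell_def)
  show ?thesis
    unfolding induces_strong_matroidal_def induced_subdivision_finite[OF fin] cells surj
    using matroid[OF sub] by simp
qed

lemma trop_V_p:
  assumes vw: "v \<in> weights" "w \<in> weights" "v \<bullet> w = - 1 / 2"
  shows "\<mu> \<in> trop_V (f_E7 p (c *\<^sub>R v) (c *\<^sub>R w)) \<longleftrightarrow> weight_trop (\<lambda>v. \<mu> (c *\<^sub>R v)) (v + w)"
proof -
  let ?\<nu> = "\<lambda>v. \<mu> (c *\<^sub>R v)" and ?\<alpha> = "v + w"
  let ?m = "\<lambda>x. {c *\<^sub>R x, c *\<^sub>R (?\<alpha> - x)}"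
  define P where "P = {x \<in> weights. ?\<alpha> - x \<in> weights}"
  have root: "?\<alpha> \<in> E7_roots" using weight_diff_root[of v "- w"] vw by simp
  have f: "f_E7 p (c *\<^sub>R v) (c *\<^sub>R w) = ?m ` P"
  proof -
    have "{{c *\<^sub>R x, c *\<^sub>R y} | x y. x \<in> weights \<and> y \<in> weights \<and> x + y = ?\<alpha>} = ?m ` P"
    proof (intro equalityI subsetI)
      fix m assume "m \<in> {{c *\<^sub>R x, c *\<^sub>R y} | x y. x \<in> weights \<and> y \<in> weights \<and> x + y = ?\<alpha>}"
      then obtain x y where xy: "m = {c *\<^sub>R x, c *\<^sub>R y}" "x \<in> weights" "y \<in> weights" "x + y = ?\<alpha>" by blast
      then have "y = ?\<alpha> - x" by (simp add: algebra_simps)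
      with xy show "m \<in> ?m ` P" unfolding P_def by blast
    next
      fix m assume "m \<in> ?m ` P"
      then obtain x where "x \<in> weights" "?\<alpha> - x \<in> weights" "m = ?m x" unfolding P_def by blast
      moreover have "x + (?\<alpha> - x) = ?\<alpha>" by simp
      ultimately show "m \<in> {{c *\<^sub>R x, c *\<^sub>R y} | x y. x \<in> weights \<and> y \<in> weights \<and> x + y = ?\<alpha>}"
        by blast
    qed
    then show ?thesis using f_E7_p[OF c p vw] by simp
  qed
  \<comment> \<open>The two members must be shown distinct, since a sum over a set would count equal
    ones only once.\<close>
  have sum: "(\<Sum>z\<in>?m x. \<mu> z) = ?\<nu> x + ?\<nu> (?\<alpha> - x)" if "x \<in> P" for x
  proof -
    have "x \<bullet> (?\<alpha> - x) = - 1 / 2" using weight_pair_inner(1)[of x "?\<alpha> - x"] that root by (simp add: P_def)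
    moreover have "x \<bullet> x = 3 / 2" using that weight_inner_self by (simp add: P_def)
    ultimately have "x \<bullet> (?\<alpha> - x) \<noteq> x \<bullet> x" by simp
    then have "x \<noteq> ?\<alpha> - x" by metis
    then have "c *\<^sub>R x \<noteq> c *\<^sub>R (?\<alpha> - x)" using c by (simp only: scaleR_cancel_left) simp
    then show ?thesis by simp
  qed
  have neq: "?m x \<noteq> ?m y \<longleftrightarrow> y \<noteq> x \<and> y \<noteq> ?\<alpha> - x" for x y
    using c unfolding doubleton_eq_iff scaleR_cancel_left by auto
  have "\<mu> \<in> trop_V (?m ` P) \<longleftrightarrow> (\<exists>x\<in>P. \<exists>y\<in>P. ?m x \<noteq> ?m y \<and>
      (\<Sum>z\<in>?m x. \<mu> z) = (\<Sum>z\<in>?m y. \<mu> z) \<and> (\<forall>z\<in>P. (\<Sum>z\<in>?m x. \<mu> z) \<le> (\<Sum>z\<in>?m z. \<mu> z)))"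
    by (simp only: trop_V_def mem_Collect_eq bex_simps ball_simps)
  also have "\<dots> \<longleftrightarrow> (\<exists>x\<in>P. \<exists>y\<in>P. y \<noteq> x \<and> y \<noteq> ?\<alpha> - x \<and>
      ?\<nu> x + ?\<nu> (?\<alpha> - x) = ?\<nu> y + ?\<nu> (?\<alpha> - y) \<and>
      (\<forall>z\<in>P. ?\<nu> x + ?\<nu> (?\<alpha> - x) \<le> ?\<nu> z + ?\<nu> (?\<alpha> - z)))"
    unfolding neq by (simp only: sum conj_assoc cong: bex_cong ball_cong)
  also have "\<dots> \<longleftrightarrow> weight_trop ?\<nu> ?\<alpha>"
    unfolding weight_trop_def P_def by (simp only: Bex_def Ball_def mem_Collect_eq) blast
  finally show ?thesis unfolding f .
qed

end

theorem theorem4p14: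
  fixes p :: "real ^ 8" and \<mu> :: "real ^ 8 \<Rightarrow> real"
  assumes "p \<in> span E7_roots" and "stabilizer_E7 p = P7"
  shows "induces_strong_matroidal p \<mu> \<longleftrightarrow>
         \<mu> \<in> (\<Inter>(A, B) \<in> {(A, B). at_edge_distance_321 p 2 A B}. trop_V (f_E7 p A B))"
proof -
  obtain c where c: "c \<noteq> 0" and p: "p = c *\<^sub>R wt 7 8"
    using point_with_stabilizer_P7[OF assms] .
  let ?\<nu> = "\<lambda>v. \<mu> (c *\<^sub>R v)"
  have "induces_strong_matroidal p \<mu> \<longleftrightarrow> (\<forall>\<alpha>\<in>E7_roots. weight_trop ?\<nu> \<alpha>)"
    unfolding induces_strong_matroidal_p[OF c p]
    using strong_exchange_cell weight_trop_of_strong_exchange by blast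
  \<comment> \<open>The roots are exactly the sums of two weights at distance 2, and the condition
    depends on the sum alone.\<close>
  also have "\<dots> \<longleftrightarrow> (\<forall>v\<in>weights. \<forall>w\<in>weights. v \<bullet> w = - 1 / 2 \<longrightarrow> weight_trop ?\<nu> (v + w))"
  proof (intro iffI ballI impI)
    fix v w assume "\<forall>\<alpha>\<in>E7_roots. weight_trop ?\<nu> \<alpha>" "v \<in> weights" "w \<in> weights" "v \<bullet> w = - 1 / 2"
    then show "weight_trop ?\<nu> (v + w)" using weight_diff_root[of v "- w"] by simp
  next
    fix \<alpha> assume *: "\<forall>v\<in>weights. \<forall>w\<in>weights. v \<bullet> w = - 1 / 2 \<longrightarrow> weight_trop ?\<nu> (v + w)"
      and \<alpha>: "\<alpha> \<in> E7_roots"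
    obtain v w where vw: "v \<in> weights" "w \<in> weights" "\<alpha> = v + w" using root_as_sum[OF \<alpha>] .
    with * weight_pair_inner(1)[of v w] \<alpha> show "weight_trop ?\<nu> \<alpha>" by simp
  qed
  also have "\<dots> \<longleftrightarrow> (\<forall>A B. at_edge_distance_321 p 2 A B \<longrightarrow> \<mu> \<in> trop_V (f_E7 p A B))"
  proof (intro iffI allI ballI impI)
    fix A B assume *: "\<forall>v\<in>weights. \<forall>w\<in>weights. v \<bullet> w = - 1 / 2 \<longrightarrow> weight_trop ?\<nu> (v + w)"
      and "at_edge_distance_321 p 2 A B"
    then obtain v w where "v \<in> weights" "w \<in> weights" "A = c *\<^sub>R v" "B = c *\<^sub>R w" "v \<bullet> w = - 1 / 2"
      unfolding at_edge_distance_2_p[OF c p] by blast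
    with * show "\<mu> \<in> trop_V (f_E7 p A B)" using trop_V_p[OF c p] by simp
  next
    fix v w assume *: "\<forall>A B. at_edge_distance_321 p 2 A B \<longrightarrow> \<mu> \<in> trop_V (f_E7 p A B)"
      and vw: "v \<in> weights" "w \<in> weights" "v \<bullet> w = - 1 / 2"
    then have "at_edge_distance_321 p 2 (c *\<^sub>R v) (c *\<^sub>R w)"
      unfolding at_edge_distance_2_p[OF c p] by blast
    with * show "weight_trop ?\<nu> (v + w)" using trop_V_p[OF c p vw] by blast
  qed
  finally show ?thesis by auto
qed

end
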